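(* The family of worm enumerators $\langle\sigma^\alpha\rangle_{\alpha\in\mathsf{On}}$ is the hyperation of the function $e:\mathsf{On}\to\mathsf{On}$, $e(\xi)=-1+\omega^\xi$.
   Context: $\mathsf{On}$ is the class of all ordinals. For $\zeta\le\xi$, $-\zeta+\xi$ is the unique ordinal $\eta$ with $\zeta+\eta=\xi$. An ordinal function is normal if it is strictly increasing and continuous at limits. Hyperation: a weak hyperation of a normal function $f$ is a family of normal functions $\langle g^\xi\rangle_{\xi\in\mathsf{On}}$ such that $g^0$ is the identity, $g^1=f$, and $g^{\xi+\zeta}=g^\xi\circ g^\zeta$ for all $\xi,\zeta$. A weak hyperation $\langle g^\xi\rangle$ of $f$ is minimal if for every weak hyperation $\langle h^\xi\rangle$ of $f$ and all ordinals $\xi,\zeta$ we have $g^\xi(\zeta)\le h^\xi(\zeta)$; the (unique) minimal weak hyperation is called the hyperation of $f$. Formulas of the Reflection Calculus $\mathsf{RC}$ are given by $\phi ::= \top \mid \phi\wedge\psi \mid \alpha\phi$ with $\alpha$ any ordinal ($\alpha\phi$ is also written $\langle\alpha\rangle\phi$). We write $\phi\vdash\psi$ if this sequent is derivable from: $\phi\vdash\phi$; $\phi\vdash\top$; $\phi\wedge\psi\vdash\phi$; $\phi\wedge\psi\vdash\psi$; $\alpha\alpha\phi\vdash\alpha\phi$; $\beta\phi\vdash\alpha\phi$ and $\beta\phi\wedge\alpha\psi\vdash\beta(\phi\wedge\alpha\psi)$ for $\alpha<\beta$; with the rules: from $\phi\vdash\psi$ and $\psi\vdash\chi$ infer $\phi\vdash\chi$;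 from $\phi\vdash\psi$ and $\phi\vdash\chi$ infer $\phi\vdash\psi\wedge\chi$; from $\phi\vdash\psi$ infer $\alpha\phi\vdash\alpha\psi$. (The polymodal provability logic $\mathsf{GLP}$ is conservative over $\mathsf{RC}$, so equivalently $\mathsf{GLP}\vdash\phi\to\psi$.) Worms: $\mathbb W$ is the least class containing $\top$ and closed under $A\mapsto\langle\alpha\rangle A$ for each ordinal $\alpha$; $\mathbb W_\xi$ is the class of worms all of whose modalities are $\geq\xi$. $A<_0 B$ iff $B\vdash\langle 0\rangle A$. The relation $<_0$ is well-founded on $\mathbb W$, and $o(A):=\sup_{B<_0 A}(o(B)+1)$ (with $\sup\varnothing=0$). The worm enumerator $\sigma^\alpha:\mathsf{On}\to\mathsf{On}$ is the function enumerating the class $o(\mathbb W_\alpha)=\{o(A): A\in\mathbb W_\alpha\}$ in increasing order (starting with argument $0$). *)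

theory Defs
  imports Main
begin

section \<open>The class of all ordinals\<close>

text \<open>
  HOL has no type of all ordinals.  We therefore work over an arbitrary type that carries the
  order-theoretic structure of \<open>On\<close>: a well-order without largest element, containing a limit
  point (Infinity), in which every function is bounded on every proper initial segment
  (Replacement for \<open>On\<close>).  Everything below is developed from the order alone and functions
  \<open>'o \<Rightarrow> 'o\<close> play the role of class functions \<open>On \<rightarrow> On\<close>.

  Read inside set theory, the order types satisfying these axioms are exactly the uncountable
  regular cardinals and \<open>On\<close> itself.  Such types exist, and of arbitrarily large
  cardinality; see the type \<open>hartogs\<close> at the end of the theory.
\<close>

class ordinals = wellorder + no_top +
  assumes limit_exists: "\<exists>l. (\<exists>x. x < l) \<and> (\<forall>x. x < l \<longrightarrow> (\<exists>y. x < y \<and> y < l))"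
    and bounded_on_initial_segment: "\<exists>b. \<forall>y. y < x \<longrightarrow> f y \<le> b"

definition zero_o :: "'o::ordinals" where
  "zero_o = (LEAST x. True)"

definition suc_o :: "'o::ordinals \<Rightarrow> 'o" where
  "suc_o x = (LEAST y. x < y)"

definition is_limit :: "'o::ordinals \<Rightarrow> bool" where
  "is_limit l \<longleftrightarrow> l \<noteq> zero_o \<and> (\<nexists>x. l = suc_o x)"

text \<open>The supremum is only meaningful for bounded sets; the supremum of the empty set is \<open>0\<close>.\<close>

definition sup_o :: "'o::ordinals set \<Rightarrow> 'o" where
  "sup_o X = (LEAST y. \<forall>x\<in>X. x \<le> y)"

definition one_o :: "'o::ordinals" where
  "one_o = suc_o zero_o"

definition omega_o :: "'o::ordinals" where
  "omega_o = (LEAST l. is_limit l)"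

definition rec_o :: "'o::ordinals \<Rightarrow> ('o \<Rightarrow> 'o) \<Rightarrow> 'o \<Rightarrow> 'o" where
  "rec_o z s = wfrec {(x, y). x < y}
     (\<lambda>r x. if x = zero_o then z
            else if \<exists>y. x = suc_o y then s (r (THE y. x = suc_o y))
            else sup_o (r ` {y. y < x}))"

definition plus_o :: "'o::ordinals \<Rightarrow> 'o \<Rightarrow> 'o"  (infixl "+\<^sub>o" 65) where
  "x +\<^sub>o y = rec_o x suc_o y"

definition times_o :: "'o::ordinals \<Rightarrow> 'o \<Rightarrow> 'o"  (infixl "*\<^sub>o" 70) where
  "x *\<^sub>o y = rec_o zero_o (\<lambda>u. u +\<^sub>o x) y"

definition omega_power :: "'o::ordinals \<Rightarrow> 'o" where
  "omega_power x = rec_o one_o (\<lambda>u. u *\<^sub>o omega_o) x"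

text \<open>\<open>left_minus \<zeta> \<xi>\<close> is \<open>-\<zeta> + \<xi>\<close>, for \<open>\<zeta> \<le> \<xi>\<close>.\<close>

definition left_minus :: "'o::ordinals \<Rightarrow> 'o \<Rightarrow> 'o" where
  "left_minus z x = (THE y. z +\<^sub>o y = x)"

definition e_fun :: "'o::ordinals \<Rightarrow> 'o" where
  "e_fun x = left_minus one_o (omega_power x)"


section \<open>Hyperations\<close>

definition normal :: "('o::ordinals \<Rightarrow> 'o) \<Rightarrow> bool" where
  "normal f \<longleftrightarrow> strict_mono f \<and> (\<forall>l. is_limit l \<longrightarrow> f l = sup_o (f ` {x. x < l}))"

definition weak_hyperation :: "('o::ordinals \<Rightarrow> 'o) \<Rightarrow> ('o \<Rightarrow> 'o \<Rightarrow> 'o) \<Rightarrow> bool" where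
  "weak_hyperation f g \<longleftrightarrow>
     normal f \<and> (\<forall>x. normal (g x)) \<and> g zero_o = id \<and> g one_o = f \<and>
     (\<forall>x z. g (x +\<^sub>o z) = g x \<circ> g z)"

definition is_hyperation :: "('o::ordinals \<Rightarrow> 'o) \<Rightarrow> ('o \<Rightarrow> 'o \<Rightarrow> 'o) \<Rightarrow> bool" where
  "is_hyperation f g \<longleftrightarrow>
     weak_hyperation f g \<and> (\<forall>h. weak_hyperation f h \<longrightarrow> (\<forall>x z. g x z \<le> h x z))"


section \<open>The Reflection Calculus\<close>

datatype 'o rc_form = Top | Conj "'o rc_form" "'o rc_form" | Dia 'o "'o rc_form"

inductive rc_derives :: "'o::ordinals rc_form \<Rightarrow> 'o rc_form \<Rightarrow> bool"  (infix "\<turnstile>" 50) where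
  rc_refl: "\<phi> \<turnstile> \<phi>"
| rc_top: "\<phi> \<turnstile> Top"
| rc_conj1: "Conj \<phi> \<psi> \<turnstile> \<phi>"
| rc_conj2: "Conj \<phi> \<psi> \<turnstile> \<psi>"
| rc_trans4: "Dia \<alpha> (Dia \<alpha> \<phi>) \<turnstile> Dia \<alpha> \<phi>"
| rc_mono: "\<alpha> < \<beta> \<Longrightarrow> Dia \<beta> \<phi> \<turnstile> Dia \<alpha> \<phi>"
| rc_import: "\<alpha> < \<beta> \<Longrightarrow> Conj (Dia \<beta> \<phi>) (Dia \<alpha> \<psi>) \<turnstile> Dia \<beta> (Conj \<phi> (Dia \<alpha> \<psi>))"
| rc_cut: "\<phi> \<turnstile> \<psi> \<Longrightarrow> \<psi> \<turnstile> \<chi> \<Longrightarrow> \<phi> \<turnstile> \<chi>"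
| rc_conjI: "\<phi> \<turnstile> \<psi> \<Longrightarrow> \<phi> \<turnstile> \<chi> \<Longrightarrow> \<phi> \<turnstile> Conj \<psi> \<chi>"
| rc_dia: "\<phi> \<turnstile> \<psi> \<Longrightarrow> Dia \<alpha> \<phi> \<turnstile> Dia \<alpha> \<psi>"


section \<open>Worms\<close>

inductive_set worms :: "'o::ordinals rc_form set" where
  "Top \<in> worms"
| "A \<in> worms \<Longrightarrow> Dia \<alpha> A \<in> worms"

fun modalities :: "'o rc_form \<Rightarrow> 'o set" where
  "modalities Top = {}"
| "modalities (Conj \<phi> \<psi>) = modalities \<phi> \<union> modalities \<psi>"
| "modalities (Dia \<alpha> \<phi>) = insert \<alpha> (modalities \<phi>)"

definition worms_ge :: "'o::ordinals \<Rightarrow> 'o rc_form set" where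
  "worms_ge \<xi> = {A \<in> worms. \<forall>\<alpha> \<in> modalities A. \<xi> \<le> \<alpha>}"

definition less_worm :: "'o::ordinals rc_form \<Rightarrow> 'o rc_form \<Rightarrow> bool"  (infix "<\<^sub>0" 50) where
  "A <\<^sub>0 B \<longleftrightarrow> B \<turnstile> Dia zero_o A"

text \<open>
  Recursion along \<open><\<^sub>0\<close> on worms.  The recursion equation is justified by the
  well-foundedness of this relation.
\<close>

definition worm_order :: "'o::ordinals rc_form \<Rightarrow> 'o" where
  "worm_order = wfrec {(B, A). B \<in> worms \<and> A \<in> worms \<and> B <\<^sub>0 A}
     (\<lambda>r A. sup_o {suc_o (r B) | B. B \<in> worms \<and> B <\<^sub>0 A})"

text \<open>A class \<open>X\<close> enumerated by all of \<open>On\<close> is necessarily unbounded; its enumerating function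
  is then the unique strictly increasing function with range \<open>X\<close>.\<close>

definition enumerator :: "'o::ordinals set \<Rightarrow> 'o \<Rightarrow> 'o" where
  "enumerator X = (THE f. strict_mono f \<and> range f = X)"

definition worm_enumerator :: "'o::ordinals \<Rightarrow> 'o \<Rightarrow> 'o" where
  "worm_enumerator \<alpha> = enumerator (worm_order ` worms_ge \<alpha>)"


section \<open>Defining equations of the arithmetic operations\<close>

lemma wf_less_ordinals: "wf {(x, y). x < (y :: 'o::ordinals)}"
  by (rule wf)

lemma zero_o_le: "zero_o \<le> (x :: 'o::ordinals)"
  unfolding zero_o_def by (rule Least_le) simp

lemma less_suc_o: "(x :: 'o::ordinals) < suc_o x"
proof -
  obtain y where "x < y" using gt_ex[of x] by blast
  then show ?thesis unfolding suc_o_def by (rule LeastI)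
qed

lemma suc_o_le: "(x :: 'o::ordinals) < y \<Longrightarrow> suc_o x \<le> y"
  unfolding suc_o_def by (rule Least_le)

lemma suc_o_neq_zero: "suc_o (x :: 'o::ordinals) \<noteq> zero_o"
  using less_suc_o[of x] zero_o_le[of x] by auto

lemma suc_o_inject: "suc_o (x :: 'o::ordinals) = suc_o y \<longleftrightarrow> x = y"
  by (metis less_suc_o linorder_neqE not_le suc_o_le)

lemma rec_o_unfold:
  fixes x :: "'o::ordinals"
  shows "rec_o z s x = (if x = zero_o then z
            else if \<exists>y. x = suc_o y then s (rec_o z s (THE y. x = suc_o y))
            else sup_o (rec_o z s ` {y. y < x}))"
proof -
  have "adm_wf {(x, y). x < y} (\<lambda>r x. if x = zero_o then z
            else if \<exists>y. x = suc_o y then s (r (THE y. x = suc_o y))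
            else sup_o (r ` {y. y < (x::'o)}))"
    unfolding adm_wf_def by (auto simp: less_suc_o suc_o_inject intro!: arg_cong[where f = sup_o])
  from wfrec_fixpoint[OF wf_less_ordinals this] show ?thesis
    unfolding rec_o_def by (rule fun_cong)
qed

lemma rec_o_zero: "rec_o z s zero_o = z"
  by (subst rec_o_unfold) simp

lemma rec_o_suc: "rec_o z s (suc_o y) = s (rec_o z s y)"
  by (subst rec_o_unfold) (simp add: suc_o_neq_zero suc_o_inject)

lemma rec_o_limit: "is_limit l \<Longrightarrow> rec_o z s l = sup_o (rec_o z s ` {y. y < l})"
  by (subst rec_o_unfold) (auto simp: is_limit_def)

lemma plus_o_simps:
  "x +\<^sub>o zero_o = x"
  "x +\<^sub>o suc_o y = suc_o (x +\<^sub>o y)"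
  "is_limit l \<Longrightarrow> x +\<^sub>o l = sup_o {x +\<^sub>o y | y. y < l}"
  by (auto simp: plus_o_def rec_o_zero rec_o_suc rec_o_limit intro: arg_cong[where f = sup_o])

lemma times_o_simps:
  "x *\<^sub>o zero_o = zero_o"
  "x *\<^sub>o suc_o y = x *\<^sub>o y +\<^sub>o x"
  "is_limit l \<Longrightarrow> x *\<^sub>o l = sup_o {x *\<^sub>o y | y. y < l}"
  by (auto simp: times_o_def rec_o_zero rec_o_suc rec_o_limit intro: arg_cong[where f = sup_o])

lemma omega_power_simps:
  "omega_power zero_o = one_o"
  "omega_power (suc_o y) = omega_power y *\<^sub>o omega_o"
  "is_limit l \<Longrightarrow> omega_power l = sup_o {omega_power y | y. y < l}"
  by (auto simp: omega_power_def rec_o_zero rec_o_suc rec_o_limit intro: arg_cong[where f = sup_o])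

lemma sup_o_initial_segment:
  fixes f :: "'o::ordinals \<Rightarrow> 'o"
  assumes "y < x"
  shows "f y \<le> sup_o (f ` {y. y < x})"
proof -
  obtain b where "\<forall>y. y < x \<longrightarrow> f y \<le> b" using bounded_on_initial_segment by blast
  then have "\<forall>u \<in> f ` {y. y < x}. u \<le> b" by auto
  then have "\<forall>u \<in> f ` {y. y < x}. u \<le> sup_o (f ` {y. y < x})"
    unfolding sup_o_def by (rule LeastI)
  with assms show ?thesis by blast
qed


section \<open>Existence\<close>

text \<open>
  The cardinal successor of \<open>max(\<aleph>\<^sub>0, |'a|)\<close>, ordered as a cardinal, is an instance of
  the class \<open>ordinals\<close>.
\<close>

abbreviation hartogs_rel :: "('a + nat) set rel" where
  "hartogs_rel \<equiv> cardSuc (card_of (UNIV :: ('a + nat) set))"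

lemma hartogs_rel:
  "Card_order (hartogs_rel :: ('a + nat) set rel)"
  "infinite (Field (hartogs_rel :: ('a + nat) set rel))"
  "regularCard (hartogs_rel :: ('a + nat) set rel)"
  "Well_order (hartogs_rel :: ('a + nat) set rel)"
proof -
  have C: "Cinfinite (card_of (UNIV :: ('a + nat) set))"
    unfolding cinfinite_def using card_of_Card_order by (simp add: Field_card_of)
  show "Card_order (hartogs_rel :: ('a + nat) set rel)"
    using Cinfinite_cardSuc[OF C] by blast
  then show "Well_order (hartogs_rel :: ('a + nat) set rel)"
    by (auto simp: card_order_on_def)
  show "infinite (Field (hartogs_rel :: ('a + nat) set rel))"
    using Cinfinite_cardSuc[OF C] unfolding cinfinite_def by blast
  show "regularCard (hartogs_rel :: ('a + nat) set rel)"
    by (rule regularCard_cardSuc[OF C])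
qed

typedef 'a hartogs = "Field (hartogs_rel :: ('a + nat) set rel)"
proof -
  have "Field (hartogs_rel :: ('a + nat) set rel) \<noteq> {}"
    using hartogs_rel(2) by (metis finite.emptyI)
  then show "\<exists>x. x \<in> Field (hartogs_rel :: ('a + nat) set rel)" by blast
qed

instantiation hartogs :: (type) linorder
begin

definition less_eq_hartogs :: "'a hartogs \<Rightarrow> 'a hartogs \<Rightarrow> bool" where
  "less_eq_hartogs x y \<longleftrightarrow> (Rep_hartogs x, Rep_hartogs y) \<in> hartogs_rel"

definition less_hartogs :: "'a hartogs \<Rightarrow> 'a hartogs \<Rightarrow> bool" where
  "less_hartogs x y \<longleftrightarrow> x \<le> y \<and> x \<noteq> y"

instance
proof
  have W: "refl_on (Field r) r" "trans r" "antisym r" "total_on (Field r) r"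
    if "r = (hartogs_rel :: ('a + nat) set rel)" for r
    using hartogs_rel(4) that
    by (auto simp: well_order_on_def linear_order_on_def partial_order_on_def preorder_on_def)
  fix x y z :: "'a hartogs"
  show "x \<le> x"
    using W(1)[OF refl] Rep_hartogs[of x] by (auto simp: less_eq_hartogs_def refl_on_def)
  show "x \<le> y \<Longrightarrow> y \<le> z \<Longrightarrow> x \<le> z"
    using W(2)[OF refl] unfolding less_eq_hartogs_def by (rule transD)
  show anti: "x \<le> y \<Longrightarrow> y \<le> x \<Longrightarrow> x = y"
    using W(3)[OF refl] unfolding less_eq_hartogs_def
    by (metis Rep_hartogs_inject antisymD)
  show "x < y \<longleftrightarrow> x \<le> y \<and> \<not> y \<le> x"
    using anti \<open>x \<le> x\<close> by (auto simp: less_hartogs_def)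
  show "x \<le> y \<or> y \<le> x"
    using W(4)[OF refl] Rep_hartogs[of x] Rep_hartogs[of y] \<open>x \<le> x\<close>
    unfolding less_eq_hartogs_def total_on_def by (metis Rep_hartogs_inject)
qed

end

lemma less_hartogs_iff:
  "x < y \<longleftrightarrow> (Rep_hartogs x, Rep_hartogs y) \<in> hartogs_rel - Id"
  by (auto simp: less_hartogs_def less_eq_hartogs_def Rep_hartogs_inject)

instance hartogs :: (type) wellorder
proof
  fix P and a :: "'a hartogs"
  assume step: "\<And>x :: 'a hartogs. (\<And>y. y < x \<Longrightarrow> P y) \<Longrightarrow> P x"
  have "wf (hartogs_rel - Id :: ('a + nat) set rel)"
    using hartogs_rel(4)[where 'a = 'a] unfolding well_order_on_def by (rule conjunct2)
  then have "wf (inv_image (hartogs_rel - Id) (Rep_hartogs :: 'a hartogs \<Rightarrow> _))"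
    by (rule wf_inv_image)
  then show "P a"
    by (induction a rule: wf_induct_rule) (auto intro: step simp: less_hartogs_iff)
qed

lemma hartogs_bounded:
  fixes K :: "'a hartogs set"
  assumes "(card_of K, hartogs_rel :: ('a + nat) set rel) \<in> ordLess"
  shows "\<exists>b. \<forall>x\<in>K. x \<le> b"
proof (rule ccontr)
  assume unbounded: "\<not> ?thesis"
  have "cofinal (Rep_hartogs ` K) (hartogs_rel :: ('a + nat) set rel)"
    unfolding cofinal_def
  proof
    fix a assume "a \<in> Field (hartogs_rel :: ('a + nat) set rel)"
    then obtain a' :: "'a hartogs" where a: "a = Rep_hartogs a'" by (metis Rep_hartogs_cases)
    from unbounded obtain x where "x \<in> K" "a' < x" by (meson not_le)
    then show "\<exists>b \<in> Rep_hartogs ` K. a \<noteq> b \<and> (a, b) \<in> hartogs_rel"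
      by (auto simp: a less_hartogs_iff)
  qed
  moreover have "Rep_hartogs ` K \<subseteq> Field hartogs_rel" using Rep_hartogs by auto
  ultimately have "(card_of (Rep_hartogs ` K), hartogs_rel :: ('a + nat) set rel) \<in> ordIso"
    using hartogs_rel(3) unfolding regularCard_def by blast
  moreover have "(card_of (Rep_hartogs ` K), hartogs_rel :: ('a + nat) set rel) \<in> ordLess"
    using card_of_image assms by (rule ordLeq_ordLess_trans)
  ultimately show False using not_ordLess_ordIso by blast
qed

instance hartogs :: (type) ordinals
proof
  show no_max: "\<exists>y. x < y" for x :: "'a hartogs"
  proof -
    obtain b where "b \<in> Field hartogs_rel" "Rep_hartogs x \<noteq> b" "(Rep_hartogs x, b) \<in> hartogs_rel"
      using infinite_Card_order_limit[OF hartogs_rel(1) hartogs_rel(2) Rep_hartogs] by blast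
    then have "x < Abs_hartogs b" by (simp add: less_hartogs_iff Abs_hartogs_inverse)
    then show ?thesis ..
  qed
  show "\<exists>b. \<forall>y. y < x \<longrightarrow> f y \<le> b" for x :: "'a hartogs" and f :: "'a hartogs \<Rightarrow> 'a hartogs"
  proof -
    have "Rep_hartogs ` {y. y < x} \<subseteq> underS hartogs_rel (Rep_hartogs x)"
      by (auto simp: underS_def less_hartogs_iff)
    from card_of_mono1[OF this] card_of_underS[OF hartogs_rel(1) Rep_hartogs]
    have "(card_of (Rep_hartogs ` {y. y < x}), hartogs_rel :: ('a + nat) set rel) \<in> ordLess"
      by (rule ordLeq_ordLess_trans)
    from ordLeq_ordLess_trans[OF card_of_image this]
    have "(card_of ((f \<circ> Abs_hartogs) ` Rep_hartogs ` {y. y < x}),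
        hartogs_rel :: ('a + nat) set rel) \<in> ordLess" .
    moreover have "f ` {y. y < x} = (f \<circ> Abs_hartogs) ` Rep_hartogs ` {y. y < x}"
      by (simp add: image_image Rep_hartogs_inverse)
    ultimately have "(card_of (f ` {y. y < x}), hartogs_rel :: ('a + nat) set rel) \<in> ordLess"
      by (simp only:)
    from hartogs_bounded[OF this] show ?thesis by auto
  qed
  show "\<exists>l :: 'a hartogs. (\<exists>x. x < l) \<and> (\<forall>x. x < l \<longrightarrow> (\<exists>y. x < y \<and> y < l))"
  proof -
    define g :: "nat \<Rightarrow> 'a hartogs" where "g = rec_nat undefined (\<lambda>_ x. SOME y. x < y)"
    have g: "g n < g (Suc n)" for n
      using someI_ex[OF no_max] by (simp add: g_def)
    have "(card_of (range g), card_of (UNIV :: ('a + nat) set)) \<in> ordLeq"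
    proof -
      have "(card_of (UNIV :: nat set), card_of (UNIV :: ('a + nat) set)) \<in> ordLeq"
        using inj_Inr by (subst card_of_ordLeq[symmetric]) blast
      with card_of_image show ?thesis by (rule ordLeq_transitive)
    qed
    then have "(card_of (range g), hartogs_rel :: ('a + nat) set rel) \<in> ordLess"
      using cardSuc_greater[OF card_of_Card_order] by (rule ordLeq_ordLess_trans)
    from hartogs_bounded[OF this] obtain b where b: "\<forall>n. g n \<le> b" by blast
    define l where "l = (LEAST l. \<forall>n. g n \<le> l)"
    have ub: "g n \<le> l" for n
      using LeastI[of "\<lambda>l. \<forall>n. g n \<le> l", OF b] unfolding l_def by blast
    have lt: "g n < l" for n
      using g[of n] ub[of "Suc n"] by simp
    have "\<exists>y. x < y \<and> y < l" if "x < l" for x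
    proof -
      have "\<not> (\<forall>n. g n \<le> x)"
        using that unfolding l_def by (rule not_less_Least)
      then obtain n where "x < g n" by (auto simp: not_le)
      with lt show ?thesis by blast
    qed
    with lt show ?thesis by blast
  qed
qed

end

theory Submission
  imports Defs
begin

text \<open>
  Write \<open>A \<prec> B\<close> for \<open>B \<turnstile> \<langle>0\<rangle>A\<close> and \<open>\<alpha>\<up>A\<close> for the worm \<open>A\<close> with all letters raised by
  \<open>\<alpha>\<close> on the left.  On worms, \<open>\<prec>\<close> is irreflexive (by a Kripke frame), linear up to equivalence,
  and preserved and reflected by \<open>\<alpha>\<up>\<close>; hence \<open>\<sigma>\<^sup>\<alpha>(o(A)) = o(\<alpha>\<up>A)\<close>, which yields the semigroup
  law.  Moreover \<open>A \<mapsto> A0C\<close> is an isomorphism onto the worms above \<open>C\<close>, so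
  \<open>o(A0C) = o(C) + 1 + o(A)\<close>, from which \<open>1 + \<sigma>\<^sup>1(\<xi>) = \<omega>\<^sup>\<xi>\<close> follows by induction on \<open>\<xi>\<close>.

  Both well-foundedness of \<open>\<prec>\<close> and minimality of \<open>\<sigma>\<close> rest on one induction over the worms
  \<open>C \<prec> \<alpha>\<up>A\<close>.  Let \<open>\<beta>\<close> be the least letter of \<open>C\<close>.  If \<open>\<alpha> \<le> \<beta>\<close>, then \<open>C = \<alpha>\<up>B\<close> with
  \<open>B \<prec> A\<close>.  Otherwise \<open>C = \<beta>\<up>(B0D)\<close> and \<open>\<alpha> = \<beta> + \<gamma>\<close> with \<open>B0D \<prec> \<gamma>\<up>A\<close>; either
  \<open>\<gamma> < \<alpha>\<close>, or \<open>\<gamma> = \<alpha>\<close> and \<open>B\<close>, \<open>D\<close> are shorter worms below \<open>\<alpha>\<up>A\<close>.  For a weak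
  hyperation \<open>h\<close> of \<open>e\<close>, the ordinal \<open>h\<^sup>\<alpha>(\<xi>)\<close> with \<open>\<alpha> > 0\<close> is a value of \<open>e = \<sigma>\<^sup>1\<close>, and the
  worms below \<open>1\<up>Z\<close> are closed under \<open>B, D \<mapsto> B0D\<close>.
\<close>

section \<open>Ordinals\<close>

lemma less_suc_o_iff: "(x :: 'o::ordinals) < suc_o y \<longleftrightarrow> x \<le> y"
  by (metis less_suc_o not_le order_le_less_trans suc_o_le)

lemma suc_o_le_iff: "suc_o (x :: 'o::ordinals) \<le> y \<longleftrightarrow> x < y"
  by (metis less_suc_o_iff not_le)

lemma not_less_zero_o: "\<not> (x :: 'o::ordinals) < zero_o"
  by (simp add: not_less zero_o_le)

lemma is_limit_zero_less: "is_limit l \<Longrightarrow> zero_o < (l :: 'o::ordinals)"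
  using zero_o_le[of l] by (auto simp: is_limit_def)

lemma is_limit_suc_less: "is_limit l \<Longrightarrow> x < l \<Longrightarrow> suc_o x < (l :: 'o::ordinals)"
  using suc_o_le[of x l] by (metis is_limit_def le_less)

lemma is_limitI:
  assumes "zero_o < l" and "\<And>x. x < l \<Longrightarrow> suc_o x < (l :: 'o::ordinals)"
  shows "is_limit l"
  unfolding is_limit_def
  using assms by (metis less_irrefl less_suc_o)

lemma ordinal_induct [case_names zero suc limit]:
  fixes x :: "'o::ordinals"
  assumes "P zero_o"
    and "\<And>y. P y \<Longrightarrow> P (suc_o y)"
    and "\<And>l. is_limit l \<Longrightarrow> (\<And>y. y < l \<Longrightarrow> P y) \<Longrightarrow> P l"
  shows "P x"
proof (induction x rule: less_induct)
  case (less x)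
  then show ?case using assms unfolding is_limit_def by (metis less_suc_o)
qed

lemma sup_o_upper:
  assumes "\<forall>x\<in>X. x \<le> b" and "x \<in> X"
  shows "x \<le> sup_o (X :: 'o::ordinals set)"
  using LeastI[of "\<lambda>y. \<forall>x\<in>X. x \<le> y", OF assms(1)] assms(2) by (simp add: sup_o_def)

lemma sup_o_least: "(\<And>x. x \<in> X \<Longrightarrow> x \<le> b) \<Longrightarrow> sup_o (X :: 'o::ordinals set) \<le> b"
  unfolding sup_o_def by (rule Least_le) blast

lemma sup_o_image_le_iff:
  fixes f :: "'o::ordinals \<Rightarrow> 'o"
  shows "sup_o (f ` {y. y < x}) \<le> b \<longleftrightarrow> (\<forall>y<x. f y \<le> b)"
proof
  show "\<forall>y<x. f y \<le> b" if "sup_o (f ` {y. y < x}) \<le> b"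
    using sup_o_initial_segment[of _ x f] that by (meson order_trans)
qed (auto intro: sup_o_least)

section \<open>Strictly increasing functions and enumerations\<close>

lemma strict_mono_ge_self:
  fixes f :: "'o::wellorder \<Rightarrow> 'o"
  assumes "strict_mono f"
  shows "x \<le> f x"
proof (induction x rule: less_induct)
  case (less x)
  show ?case
    using assms by (metis less less_irrefl not_le strict_monoD order_le_less_trans)
qed

lemma strict_mono_range_unique:
  fixes f g :: "'o::wellorder \<Rightarrow> 'o"
  assumes f: "strict_mono f" and g: "strict_mono g" and r: "range f = range g"
  shows "f = g"
proof
  fix x
  show "f x = g x"
  proof (induction x rule: less_induct)
    case (less x)
    have le: "u x \<le> v x" if u: "strict_mono u" and v: "strict_mono v" and r: "range u = range v"
      and eq: "\<And>y. y < x \<Longrightarrow> u y = v y" for u v :: "'o \<Rightarrow> 'o"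
    proof -
      obtain y where y: "v x = u y" using r by (metis rangeE rangeI)
      have "\<not> y < x"
        using eq[of y] y strict_monoD[OF v, of y x] by auto
      then show ?thesis
        using strict_mono_less_eq[OF u] y by simp
    qed
    show ?case
      using le[OF f g r] le[OF g f r[symmetric]] less by (simp add: order_antisym)
  qed
qed

lemma enumerator_eq:
  assumes "strict_mono f" and "range f = (X :: 'o::ordinals set)"
  shows "enumerator X = f"
  unfolding enumerator_def
  using assms by (auto intro!: the_equality strict_mono_range_unique)

section \<open>Normal functions\<close>

lemma normalI:
  fixes f :: "'o::ordinals \<Rightarrow> 'o"
  assumes suc: "\<And>x. f x < f (suc_o x)"
    and limit: "\<And>l. is_limit l \<Longrightarrow> f l = sup_o (f ` {x. x < l})"
  shows "normal f"
proof -
  have "f x < f y" if "x < y" for x y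
    using that
  proof (induction y rule: ordinal_induct)
    case zero
    then show ?case by (simp add: not_less_zero_o)
  next
    case (suc y)
    then show ?case using assms(1)[of y] by (force simp: less_suc_o_iff le_less)
  next
    case (limit l)
    have "f x < f (suc_o x)" by (rule suc)
    also have "\<dots> \<le> f l"
      using sup_o_initial_segment[OF is_limit_suc_less[OF limit.hyps limit.prems], of f]
      by (simp add: assms(2)[OF limit.hyps])
    finally show ?case .
  qed
  then show ?thesis
    using limit by (simp add: normal_def strict_mono_def)
qed

lemma normal_limit_le_iff:
  "normal f \<Longrightarrow> is_limit l \<Longrightarrow> f l \<le> b \<longleftrightarrow> (\<forall>x<l. f x \<le> b)"
  by (simp add: normal_def sup_o_image_le_iff)

lemma normal_less_limitE:
  assumes "normal f" and "is_limit l" and "b < f l"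
  obtains x where "x < (l :: 'o::ordinals)" and "b < f x"
  using normal_limit_le_iff[OF assms(1,2), of b] assms(3) by (metis not_le)

lemma normalI_limit_le:
  fixes f :: "'o::ordinals \<Rightarrow> 'o"
  assumes "strict_mono f" and "\<And>l b. is_limit l \<Longrightarrow> (\<And>x. x < l \<Longrightarrow> f x \<le> b) \<Longrightarrow> f l \<le> b"
  shows "normal f"
  unfolding normal_def
proof (intro conjI allI impI antisym)
  fix l :: 'o assume l: "is_limit l"
  show "f l \<le> sup_o (f ` {x. x < l})"
    using l sup_o_initial_segment by (rule assms(2))
  show "sup_o (f ` {x. x < l}) \<le> f l"
    unfolding sup_o_image_le_iff
    using assms(1) by (meson less_imp_le strict_monoD)
qed (fact assms)

lemma normal_id: "normal (id :: 'o::ordinals \<Rightarrow> 'o)"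
proof (rule normalI_limit_le)
  show "strict_mono (id :: 'o \<Rightarrow> 'o)" by (simp add: strict_mono_def)
  show "id l \<le> b" if "is_limit l" "\<And>x. x < l \<Longrightarrow> id x \<le> b" for l b :: 'o
    using that is_limit_suc_less[of l b] less_suc_o[of b] by (metis id_apply not_le)
qed

lemma normal_is_limit:
  assumes "normal f" and l: "is_limit (l :: 'o::ordinals)"
  shows "is_limit (f l)"
proof (rule is_limitI)
  have sm: "strict_mono f" using assms by (simp add: normal_def)
  show "zero_o < f l"
    using is_limit_zero_less[OF l] strict_mono_ge_self[OF sm, of l] by simp
  show "suc_o y < f l" if y: "y < f l" for y
  proof -
    obtain x where x: "x < l" "y < f x"
      using normal_less_limitE[OF assms y] .
    then show ?thesis
      using strict_monoD[OF sm x(1)] suc_o_le[of y "f x"] by simp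
  qed
qed

lemma normal_comp:
  assumes f: "normal f" and g: "normal (g :: 'o::ordinals \<Rightarrow> 'o)"
  shows "normal (\<lambda>x. f (g x))"
proof (rule normalI_limit_le)
  have sf: "strict_mono f" and sg: "strict_mono g" using f g by (simp_all add: normal_def)
  then show "strict_mono (\<lambda>x. f (g x))" by (simp add: strict_mono_def)
  fix l b :: 'o assume l: "is_limit l" and b: "\<And>x. x < l \<Longrightarrow> f (g x) \<le> b"
  have "f y \<le> b" if y: "y < g l" for y
  proof -
    obtain x where "x < l" "y < g x"
      using normal_less_limitE[OF g l y] .
    then show ?thesis using b strict_monoD[OF sf] by fastforce
  qed
  then show "f (g l) \<le> b" using normal_limit_le_iff[OF f normal_is_limit[OF g l]] by simp
qed

text \<open>Stated for continuous functions so that it covers \<open>omega_power\<close>, which is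
  given by its recursion equations alone.\<close>

lemma continuous_eqI:
  fixes f g :: "'o::ordinals \<Rightarrow> 'o"
  assumes "\<And>l. is_limit l \<Longrightarrow> f l = sup_o (f ` {x. x < l})"
    and "\<And>l. is_limit l \<Longrightarrow> g l = sup_o (g ` {x. x < l})"
    and "f zero_o = g zero_o"
    and "\<And>x. f x = g x \<Longrightarrow> f (suc_o x) = g (suc_o x)"
  shows "f x = g x"
proof (induction x rule: ordinal_induct)
  case zero
  show ?case by (fact assms(3))
next
  case (suc x)
  then show ?case by (rule assms(4))
next
  case (limit l)
  then have "f ` {x. x < l} = g ` {x. x < l}" by (auto intro!: image_cong)
  then show ?case unfolding assms(1)[OF limit.hyps] assms(2)[OF limit.hyps] by simp
qed

lemma normal_eqI:
  assumes "normal f" and "normal (g :: 'o::ordinals \<Rightarrow> 'o)"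
    and "f zero_o = g zero_o"
    and "\<And>x. f x = g x \<Longrightarrow> f (suc_o x) = g (suc_o x)"
  shows "f x = g x"
proof (rule continuous_eqI[of f g])
  show "f l = sup_o (f ` {x. x < l})" "g l = sup_o (g ` {x. x < l})" if "is_limit l" for l
    using assms(1,2) that unfolding normal_def by blast+
qed (fact assms)+

section \<open>Ordinal addition and left subtraction\<close>

lemma normal_plus_o: "normal (\<lambda>y. (x :: 'o::ordinals) +\<^sub>o y)"
proof (rule normalI)
  show "x +\<^sub>o l = sup_o ((+\<^sub>o) x ` {y. y < l})" if "is_limit l" for l
    using that by (simp add: plus_o_simps(3) image_Collect)
qed (simp add: plus_o_simps less_suc_o)

lemma strict_mono_plus_o: "strict_mono (\<lambda>y. (x :: 'o::ordinals) +\<^sub>o y)"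
  using normal_plus_o[of x] unfolding normal_def by blast

lemma plus_o_less_iff [simp]: "(x :: 'o::ordinals) +\<^sub>o y < x +\<^sub>o z \<longleftrightarrow> y < z"
  using strict_mono_less[OF strict_mono_plus_o] .

lemma plus_o_le_iff [simp]: "(x :: 'o::ordinals) +\<^sub>o y \<le> x +\<^sub>o z \<longleftrightarrow> y \<le> z"
  using strict_mono_less_eq[OF strict_mono_plus_o] .

lemma plus_o_eq_iff [simp]: "(x :: 'o::ordinals) +\<^sub>o y = x +\<^sub>o z \<longleftrightarrow> y = z"
  using strict_mono_eq[OF strict_mono_plus_o] .

lemma zero_plus_o [simp]: "zero_o +\<^sub>o (x :: 'o::ordinals) = x"
  using normal_eqI[OF normal_plus_o[of zero_o] normal_id, of x] by (simp add: plus_o_simps)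

lemma plus_o_assoc: "(x :: 'o::ordinals) +\<^sub>o y +\<^sub>o z = x +\<^sub>o (y +\<^sub>o z)"
  by (rule normal_eqI[OF normal_plus_o[of "x +\<^sub>o y"] normal_comp[OF normal_plus_o[of x] normal_plus_o[of y]]])
    (simp_all add: plus_o_simps)

lemma plus_o_one: "(x :: 'o::ordinals) +\<^sub>o one_o = suc_o x"
  by (simp add: one_o_def plus_o_simps)

lemma le_plus_o: "(x :: 'o::ordinals) \<le> x +\<^sub>o y"
  using plus_o_le_iff[of x zero_o y] by (simp add: plus_o_simps zero_o_le)

lemma le_plus_o': "(x :: 'o::ordinals) \<le> y +\<^sub>o x"
  using strict_mono_ge_self[OF strict_mono_plus_o] .

text \<open>The least z with \<open>y \<le> x +\<^sub>o z\<close> cannot overshoot y: at a successor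
  the previous value is still below y, and at a limit continuity keeps the value at most y.\<close>

lemma plus_o_difference:
  assumes "(x :: 'o::ordinals) \<le> y"
  obtains z where "x +\<^sub>o z = y"
proof -
  define z where "z = (LEAST z. y \<le> x +\<^sub>o z)"
  have ge: "y \<le> x +\<^sub>o z" unfolding z_def using le_plus_o' by (rule LeastI)
  have less: "x +\<^sub>o u < y" if "u < z" for u
    using not_less_Least[of u "\<lambda>z. y \<le> x +\<^sub>o z"] that by (simp add: z_def not_le)
  consider "z = zero_o" | u where "z = suc_o u" | "is_limit z"
    unfolding is_limit_def by blast
  then have "x +\<^sub>o z \<le> y"
  proof cases
    case 1
    then show ?thesis using assms by (simp add: plus_o_simps)
  next
    case (2 u)
    then show ?thesis using less[of u] by (simp add: plus_o_simps suc_o_le less_suc_o)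
  next
    case 3
    then show ?thesis using less normal_limit_le_iff[OF normal_plus_o] by (metis less_imp_le)
  qed
  with ge that show ?thesis by auto
qed

lemma plus_o_mono_left: "(x :: 'o::ordinals) \<le> y \<Longrightarrow> x +\<^sub>o z \<le> y +\<^sub>o z"
  by (metis le_plus_o' plus_o_assoc plus_o_difference plus_o_le_iff)

lemma range_plus_o: "range ((+\<^sub>o) (x :: 'o::ordinals)) = {x..}"
  by (auto simp: le_plus_o) (metis plus_o_difference rangeI)

lemma left_minus_eq: "left_minus (x :: 'o::ordinals) (x +\<^sub>o y) = y"
  by (simp add: left_minus_def)

section \<open>The ordinal omega and bounds on sets of ordinals\<close>

lemma is_limit_omega_o: "is_limit (omega_o :: 'o::ordinals)"
proof -
  obtain l :: 'o where l: "\<exists>x. x < l" "\<And>x. x < l \<Longrightarrow> \<exists>y. x < y \<and> y < l"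
    using limit_exists by blast
  have "is_limit l"
  proof (rule is_limitI)
    show "zero_o < l" using l(1) zero_o_le by (metis order_le_less_trans)
    show "suc_o x < l" if "x < l" for x using l(2)[OF that] suc_o_le by (metis order_le_less_trans)
  qed
  then show ?thesis unfolding omega_o_def by (rule LeastI)
qed

lemma less_omega_o_induct [consumes 1, case_names zero suc]:
  assumes "n < (omega_o :: 'o::ordinals)" and "P zero_o"
    and "\<And>n. n < omega_o \<Longrightarrow> P n \<Longrightarrow> P (suc_o n)"
  shows "P n"
  using assms(1)
proof (induction n rule: ordinal_induct)
  case (suc y)
  then show ?case using assms(3) less_suc_o by (metis less_trans)
next
  case (limit l)
  then show ?case unfolding omega_o_def using not_less_Least by blast
qed (rule assms(2))

lemma times_omega_o_le_iff:
  "x *\<^sub>o omega_o \<le> b \<longleftrightarrow> (\<forall>n < (omega_o :: 'o::ordinals). x *\<^sub>o n \<le> b)"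
  using sup_o_image_le_iff[of "\<lambda>n. x *\<^sub>o n" omega_o b]
  by (simp add: times_o_simps(3)[OF is_limit_omega_o] image_Collect)

lemma bounded_on_nat: "\<exists>b. \<forall>n. f (n :: nat) \<le> (b :: 'o::ordinals)"
proof -
  define g :: "nat \<Rightarrow> 'o" where "g n = (suc_o ^^ n) zero_o" for n
  have "strict_mono g" by (simp add: strict_mono_Suc_iff g_def less_suc_o)
  then have inj: "inj g" by (rule strict_mono_imp_inj_on)
  have less: "g n < omega_o" for n
    by (induction n)
      (simp_all add: g_def is_limit_zero_less is_limit_suc_less is_limit_omega_o)
  obtain b where "\<forall>y. y < omega_o \<longrightarrow> f (inv g y) \<le> b"
    using bounded_on_initial_segment[of omega_o "\<lambda>y. f (inv g y)"] by blast
  then show ?thesis using less inv_f_f[OF inj] by metis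
qed

text \<open>Replacement for lists: the bounding axiom handles the head in an induction on the
  length, and \<open>bounded_on_nat\<close> collects the lengths. This keeps the suprema that define
  worm orders bounded.\<close>

lemma bounded_on_lists:
  fixes f :: "'o::ordinals list \<Rightarrow> 'o"
  shows "\<exists>b. \<forall>xs. (\<forall>x\<in>set xs. x < m) \<longrightarrow> f xs \<le> b"
proof -
  have "\<exists>b. \<forall>xs. length xs = n \<and> (\<forall>x\<in>set xs. x < m) \<longrightarrow> f xs \<le> b" for n
  proof (induction n arbitrary: f)
    case (Suc n)
    have "\<forall>a. \<exists>b. \<forall>xs. length xs = n \<and> (\<forall>x\<in>set xs. x < m) \<longrightarrow> f (a # xs) \<le> b"
      using Suc[of "\<lambda>xs. f (_ # xs)"] by (rule allI)
    then obtain B where B: "\<And>a xs. length xs = n \<Longrightarrow> \<forall>x\<in>set xs. x < m \<Longrightarrow> f (a # xs) \<le> B a"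
      by metis
    obtain b where "\<forall>a. a < m \<longrightarrow> B a \<le> b" using bounded_on_initial_segment by blast
    then have "f (a # xs) \<le> b" if "length xs = n" "\<forall>x\<in>set (a # xs). x < m" for a xs
      using that B[of xs a] by (auto intro: order_trans)
    then show ?case by (metis length_Suc_conv)
  qed (metis length_0_conv order_refl)
  then obtain B where B: "\<And>n xs. length xs = n \<Longrightarrow> \<forall>x\<in>set xs. x < m \<Longrightarrow> f xs \<le> B n"
    by metis
  obtain b where "\<forall>n. B n \<le> b" using bounded_on_nat by blast
  then show ?thesis using B by (metis order_trans)
qed

section \<open>Irreflexivity\<close>

definition worm :: "'o::ordinals list \<Rightarrow> 'o rc_form" where
  "worm A = foldr Dia A Top"

lemma worm_simps [simp]:
  "worm [] = Top"
  "worm (\<alpha> # A) = Dia \<alpha> (worm A)"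
  by (simp_all add: worm_def)

lemma range_worm: "range worm = worms"
proof
  have "worm A \<in> worms" for A :: "'a list" by (induction A) (auto intro: worms.intros)
  then show "range worm \<subseteq> (worms :: 'a rc_form set)" by auto
  show "worms \<subseteq> range (worm :: 'a list \<Rightarrow> _)"
  proof
    fix x :: "'a rc_form" assume "x \<in> worms"
    then show "x \<in> range worm"
      by induction (metis worm_simps(1) rangeI, metis worm_simps(2) rangeE rangeI)
  qed
qed

lemma modalities_worm: "modalities (worm A) = set A"
  by (induction A) auto

lemma rc_mono_le: "\<alpha> \<le> \<beta> \<Longrightarrow> Dia \<beta> \<phi> \<turnstile> Dia \<alpha> \<phi>"
  by (cases "\<alpha> = \<beta>") (auto intro: rc_mono rc_refl)

lemma rc_dia_dia: "\<alpha> \<le> \<beta> \<Longrightarrow> Dia \<beta> (Dia \<alpha> \<phi>) \<turnstile> Dia \<alpha> \<phi>"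
  by (rule rc_cut[OF rc_mono_le rc_trans4])

lemma rc_cut_dia: "\<phi> \<turnstile> Dia \<alpha> \<psi> \<Longrightarrow> \<psi> \<turnstile> \<chi> \<Longrightarrow> \<phi> \<turnstile> Dia \<alpha> \<chi>"
  by (rule rc_cut[OF _ rc_dia])

lemma worm_append_mono: "worm A \<turnstile> worm B \<Longrightarrow> worm (S @ A) \<turnstile> worm (S @ B)"
  by (induction S) (auto intro: rc_dia)

lemma worm_prefix: "worm (S @ T) \<turnstile> worm S"
  using worm_append_mono[of T "[]" S] by (simp add: rc_top)

lemma worm_suffix: "\<forall>x\<in>set S. \<beta> \<le> x \<Longrightarrow> worm (S @ \<beta> # T) \<turnstile> Dia \<beta> (worm T)"
  by (induction S) (auto intro: rc_refl rc_cut[OF rc_dia rc_dia_dia])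

text \<open>Iterating the import axiom moves \<langle>\<beta>\<rangle>T below every letter of S.
  With \<open>worm_prefix\<close> and \<open>worm_suffix\<close>, the joined worm is equivalent to
  the conjunction of S and \<langle>\<beta>\<rangle>T.\<close>

lemma worm_joinI:
  assumes "\<forall>x\<in>set S. \<beta> < x" and "\<phi> \<turnstile> worm S" and "\<phi> \<turnstile> Dia \<beta> (worm T)"
  shows "\<phi> \<turnstile> worm (S @ \<beta> # T)"
proof -
  have "Conj (worm S) (Dia \<beta> (worm T)) \<turnstile> worm (S @ \<beta> # T)"
    using assms(1)
  proof (induction S)
    case Nil
    show ?case by (simp add: rc_conj2)
  next
    case (Cons a S)
    have "Conj (Dia a (worm S)) (Dia \<beta> (worm T)) \<turnstile> Dia a (Conj (worm S) (Dia \<beta> (worm T)))"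
      using Cons.prems by (simp add: rc_import)
    then show ?case using Cons by (auto intro: rc_cut_dia)
  qed
  then show ?thesis by (rule rc_cut[OF rc_conjI[OF assms(2,3)]])
qed

text \<open>
  The frame of the worm \<open>c (n - 1) \<dots> c 0 \<top>\<close> is the closure of the chain
  \<open>n \<rightarrow> n - 1 \<rightarrow> \<dots> \<rightarrow> 0\<close>, with the step from \<open>j + 1\<close> to \<open>j\<close> labelled \<open>c j\<close>, under
  transitivity, monotonicity, and the first-order condition for the import axiom:
  \<open>x R\<^sub>\<beta> y\<close> and \<open>x R\<^sub>\<alpha> z\<close> with \<open>\<alpha> < \<beta>\<close> imply \<open>y R\<^sub>\<alpha> z\<close>.
  Such a frame has reflexive points, but its root is never reached.
\<close>

definition frame_rel :: "(nat \<Rightarrow> 'o::ordinals) \<Rightarrow> nat \<Rightarrow> 'o \<Rightarrow> nat \<Rightarrow> nat \<Rightarrow> bool" where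
  "frame_rel c n \<gamma> x y \<longleftrightarrow> (\<exists>i\<le>n. x \<le> i \<and> y < i \<and>
     (\<forall>j. x \<le> j \<and> j < i \<longrightarrow> \<gamma> < c j) \<and> (\<forall>j. y \<le> j \<and> j < i \<longrightarrow> \<gamma> \<le> c j))"

lemma frame_rel_mono: "frame_rel c n \<beta> x y \<Longrightarrow> \<alpha> \<le> \<beta> \<Longrightarrow> frame_rel c n \<alpha> x y"
  unfolding frame_rel_def by (meson order_le_less_trans order_trans)

lemma frame_rel_trans:
  assumes "frame_rel c n \<gamma> x y" and "frame_rel c n \<gamma> y z"
  shows "frame_rel c n \<gamma> x z"
proof -
  obtain i where i: "i \<le> n" "x \<le> i" "y < i" "\<And>j. x \<le> j \<Longrightarrow> j < i \<Longrightarrow> \<gamma> < c j"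
    "\<And>j. y \<le> j \<Longrightarrow> j < i \<Longrightarrow> \<gamma> \<le> c j"
    using assms(1) unfolding frame_rel_def by blast
  obtain k where k: "k \<le> n" "y \<le> k" "z < k" "\<And>j. y \<le> j \<Longrightarrow> j < k \<Longrightarrow> \<gamma> < c j"
    "\<And>j. z \<le> j \<Longrightarrow> j < k \<Longrightarrow> \<gamma> \<le> c j"
    using assms(2) unfolding frame_rel_def by blast
  show ?thesis
    unfolding frame_rel_def
  proof (intro exI[of _ "max i k"] conjI allI impI)
    fix j assume j: "x \<le> j \<and> j < max i k"
    show "\<gamma> < c j" using j i(3) i(4)[of j] k(4)[of j] by (cases "j < i") (auto simp: less_max_iff_disj)
  next
    fix j assume j: "z \<le> j \<and> j < max i k"
    show "\<gamma> \<le> c j" using j i(5)[of j] k(2) k(5)[of j] by (cases "j < k") (auto simp: less_max_iff_disj)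
  qed (use i k in auto)
qed

lemma frame_rel_import:
  assumes "frame_rel c n \<beta> x y" and "frame_rel c n \<alpha> x z" and "\<alpha> < \<beta>"
  shows "frame_rel c n \<alpha> y z"
proof -
  obtain i where i: "i \<le> n" "x \<le> i" "y < i" "\<And>j. x \<le> j \<Longrightarrow> j < i \<Longrightarrow> \<beta> < c j"
    "\<And>j. y \<le> j \<Longrightarrow> j < i \<Longrightarrow> \<beta> \<le> c j"
    using assms(1) unfolding frame_rel_def by blast
  obtain k where k: "k \<le> n" "x \<le> k" "z < k" "\<And>j. x \<le> j \<Longrightarrow> j < k \<Longrightarrow> \<alpha> < c j"
    "\<And>j. z \<le> j \<Longrightarrow> j < k \<Longrightarrow> \<alpha> \<le> c j"
    using assms(2) unfolding frame_rel_def by blast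
  show ?thesis
    unfolding frame_rel_def
  proof (intro exI[of _ "max i k"] conjI allI impI)
    fix j assume j: "y \<le> j \<and> j < max i k"
    show "\<alpha> < c j" using j i(2) i(5)[of j] k(4)[of j] assms(3) by (cases "j < i") (auto simp: less_max_iff_disj)
  next
    fix j assume j: "z \<le> j \<and> j < max i k"
    show "\<alpha> \<le> c j" using j i(4)[of j] k(2) k(5)[of j] assms(3) by (cases "j < k") (auto simp: less_max_iff_disj)
  qed (use i k in auto)
qed

fun forces :: "(nat \<Rightarrow> 'o::ordinals) \<Rightarrow> nat \<Rightarrow> nat \<Rightarrow> 'o rc_form \<Rightarrow> bool" where
  "forces c n x Top \<longleftrightarrow> True"
| "forces c n x (Conj \<phi> \<psi>) \<longleftrightarrow> forces c n x \<phi> \<and> forces c n x \<psi>"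
| "forces c n x (Dia \<alpha> \<phi>) \<longleftrightarrow> (\<exists>y. frame_rel c n \<alpha> x y \<and> forces c n y \<phi>)"

lemma forces_sound: "\<phi> \<turnstile> \<psi> \<Longrightarrow> forces c n x \<phi> \<Longrightarrow> forces c n x \<psi>"
proof (induction arbitrary: x rule: rc_derives.induct)
  case (rc_import \<alpha> \<beta> \<phi> \<psi>)
  then show ?case using frame_rel_import by fastforce
qed (auto intro: frame_rel_trans frame_rel_mono less_imp_le)

text \<open>Split at the first occurrence of the least letter. The tail is forced at a point that
  cannot drop below l, because the smaller letter \<open>c (l - 1)\<close> blocks the step. Two
  appeals to induction then push k above that occurrence and past the head. With l = 0, no point
  below the root forces the whole worm.\<close>

lemma forces_worm_segment:
  fixes c :: "nat \<Rightarrow> 'o::ordinals"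
  assumes "l \<le> p" and "l = 0 \<or> (\<forall>j. l \<le> j \<and> j < p \<longrightarrow> c (l - 1) < c j)"
    and "forces c n k (worm (rev (map c [l..<p])))" and "l \<le> k"
  shows "p \<le> k"
  using assms
proof (induction "p - l" arbitrary: l p k rule: less_induct)
  case less
  show ?case
  proof (cases "l = p")
    case False
    then have "l < p" using less.prems by simp
    define \<mu> where "\<mu> = Min (c ` {l..<p})"
    have min: "\<mu> \<le> c j" if "l \<le> j" "j < p" for j
      unfolding \<mu>_def using that by (intro Min_le) auto
    have "\<mu> \<in> c ` {l..<p}" unfolding \<mu>_def using \<open>l < p\<close> by (intro Min_in) auto
    then have ex: "{j. l \<le> j \<and> j < p \<and> c j = \<mu>} \<noteq> {}" (is "?S \<noteq> {}") by force
    \<comment> \<open>The worm lists positions downwards, so the greatest position of \<mu> is its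
      first occurrence in the worm.\<close>
    define q where "q = Max ?S"
    have "q \<in> ?S" unfolding q_def using ex by (intro Max_in) auto
    then have q: "l \<le> q" "q < p" "c q = \<mu>" by auto
    have "j \<le> q" if "l \<le> j" "j < p" "c j = \<mu>" for j
      unfolding q_def using that by (intro Max_ge) auto
    then have gt: "\<mu> < c j" if "q < j" "j < p" for j
      using that q min[of j] by (metis leD le_less less_trans order_le_less_trans)
    let ?S = "rev (map c [Suc q..<p])" and ?T = "rev (map c [l..<q])"
    have "[l..<p] = [l..<q] @ q # [Suc q..<p]"
      using q by (metis le_add_diff_inverse less_imp_le upt_add_eq_append upt_conv_Cons)
    then have split: "rev (map c [l..<p]) = ?S @ \<mu> # ?T" using q by simp
    have S: "forces c n k (worm ?S)"
      using less.prems(3) forces_sound worm_prefix split by metis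
    have "worm (?S @ \<mu> # ?T) \<turnstile> Dia \<mu> (worm ?T)"
      using gt by (intro worm_suffix) (auto simp: Suc_le_eq less_imp_le)
    then obtain k' where k': "frame_rel c n \<mu> k k'" "forces c n k' (worm ?T)"
      using less.prems(3) forces_sound split by fastforce
    obtain i where i: "k \<le> i" "k' < i" "\<And>j. k \<le> j \<Longrightarrow> j < i \<Longrightarrow> \<mu> < c j"
      "\<And>j. k' \<le> j \<Longrightarrow> j < i \<Longrightarrow> \<mu> \<le> c j"
      using k'(1) unfolding frame_rel_def by blast
    have "l \<le> k'"
    proof (rule ccontr)
      assume "\<not> l \<le> k'"
      then have "\<mu> \<le> c (l - 1)" "l \<noteq> 0" using i(4)[of "l - 1"] i(1) less.prems(4) by auto
      moreover have "c (l - 1) < \<mu>" using less.prems(2) q \<open>l \<noteq> 0\<close> by auto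
      ultimately show False by simp
    qed
    then have "q \<le> k'"
      using less.hyps[of q l k'] k'(2) less.prems(2) q by auto
    \<comment> \<open>If k were at most q, the climb from k to i in this \<mu>-step would cross q,
      whose label \<mu> is not above \<mu>.\<close>
    then have "q < k" using i(2) i(3)[of q] q(3) by (metis less_irrefl not_le order_le_less_trans)
    then show ?thesis
      using less.hyps[of p "Suc q" k] S q gt by (auto simp: Suc_le_eq)
  qed (use less.prems in simp)
qed

text \<open>In the frame of A the root forces A along the chain, whereas any diamond leads from the
  root to a point strictly below it, where A fails by \<open>forces_worm_segment\<close>.\<close>

lemma worm_irrefl: "\<not> worm A \<turnstile> Dia \<alpha> (worm A)"
proof
  assume derives: "worm A \<turnstile> Dia \<alpha> (worm A)"
  let ?n = "length A" and ?c = "\<lambda>j. rev A ! j"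
  have A: "rev (map ?c [0..<?n]) = A" by (metis length_rev map_nth rev_rev_ident)
  have step: "frame_rel ?c ?n (?c m) (Suc m) m" if "m < ?n" for m
    unfolding frame_rel_def using that
    by (intro exI[of _ "Suc m"]) (auto simp: less_Suc_eq_le)
  have "forces ?c ?n m (worm (rev (map ?c [0..<m])))" if "m \<le> ?n" for m
    using that
  proof (induction m)
    case (Suc m)
    then show ?case using step[of m] by auto
  qed simp
  from this[of ?n] have "forces ?c ?n ?n (worm A)" by (simp add: A)
  from forces_sound[OF derives this]
  obtain k where "frame_rel ?c ?n \<alpha> ?n k" "forces ?c ?n k (worm A)" by auto
  then have "k < ?n" "forces ?c ?n k (worm A)"
    by (auto simp: frame_rel_def)
  then show False using forces_worm_segment[of 0 ?n ?c ?n k] by (simp add: A)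
qed

section \<open>The order of worms\<close>

definition prec :: "'o::ordinals list \<Rightarrow> 'o list \<Rightarrow> bool"  (infix "\<prec>" 50) where
  "A \<prec> B \<longleftrightarrow> worm B \<turnstile> Dia zero_o (worm A)"

definition equi :: "'o::ordinals list \<Rightarrow> 'o list \<Rightarrow> bool"  (infix "\<approx>" 50) where
  "A \<approx> B \<longleftrightarrow> worm A \<turnstile> worm B \<and> worm B \<turnstile> worm A"

lemma equi_refl [simp]: "A \<approx> A"
  by (simp add: equi_def rc_refl)

lemma prec_trans: "A \<prec> B \<Longrightarrow> B \<prec> C \<Longrightarrow> A \<prec> C"
  unfolding prec_def by (rule rc_cut[OF rc_cut_dia rc_trans4])

lemma prec_derives: "A \<prec> B \<Longrightarrow> worm C \<turnstile> worm B \<Longrightarrow> A \<prec> C"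
  unfolding prec_def by (rule rc_cut)

lemma derives_prec: "worm B \<turnstile> worm A \<Longrightarrow> B \<prec> C \<Longrightarrow> A \<prec> C"
  unfolding prec_def by (rule rc_cut_dia)

lemma derives_dia_prec: "worm B \<turnstile> Dia \<alpha> (worm A) \<Longrightarrow> A \<prec> B"
  unfolding prec_def by (rule rc_cut[OF _ rc_mono_le[OF zero_o_le]])

lemma prec_irrefl [simp]: "\<not> A \<prec> A"
  by (simp add: prec_def worm_irrefl)

lemma prec_asym: "A \<prec> B \<Longrightarrow> \<not> B \<prec> A"
  using prec_trans prec_irrefl by blast

lemma equi_not_prec: "A \<approx> B \<Longrightarrow> \<not> A \<prec> B"
  using derives_prec[of A B B] by (auto simp: equi_def)

lemma split_at_least_letter:
  assumes "\<forall>x\<in>set A. \<mu> \<le> (x :: 'o::ordinals)"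
  obtains A0 where "\<forall>x\<in>set A0. \<mu> < x" and "A = A0" and "\<mu> \<notin> set A"
  | A0 A1 where "\<forall>x\<in>set A0. \<mu> < x" and "A = A0 @ \<mu> # A1" and "\<mu> \<in> set A"
proof (cases "\<mu> \<in> set A")
  case True
  then obtain A0 A1 where "A = A0 @ \<mu> # A1" "\<mu> \<notin> set A0" by (metis split_list_first)
  then show ?thesis using that(2)[of A0 A1] assms by (force simp: le_less)
next
  case False
  then show ?thesis using that(1) assms by (force simp: le_less)
qed

text \<open>
  If the tails after the first occurrence of the least letter do not settle the comparison,
  the comparison of the heads does: a derivable \<open>\<langle>\<mu>\<rangle>\<close>-formula can be imported below
  \<open>\<langle>\<mu> + 1\<rangle>\<close>.
\<close>

lemma worm_trichotomy:
  fixes A B :: "'o::ordinals list"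
  assumes "\<forall>x\<in>set A \<union> set B. \<alpha> \<le> x"
  shows "worm A \<turnstile> Dia \<alpha> (worm B) \<or> worm B \<turnstile> Dia \<alpha> (worm A) \<or> A \<approx> B"
  using assms
proof (induction "length A + length B" arbitrary: A B \<alpha> rule: less_induct)
  case less
  show ?case
  proof (cases "set A \<union> set B = {}")
    case False
    define \<mu> where "\<mu> = Min (set A \<union> set B)"
    have \<mu>: "\<mu> \<in> set A \<union> set B" unfolding \<mu>_def using False by (intro Min_in) auto
    have ge: "\<forall>x\<in>set A \<union> set B. \<mu> \<le> x" unfolding \<mu>_def by auto
    have "\<alpha> \<le> \<mu>" using \<mu> less.prems by blast
    obtain A0 where A0: "\<forall>x\<in>set A0. \<mu> < x"
      "A = A0 \<and> \<mu> \<notin> set A \<or> (\<exists>A1. A = A0 @ \<mu> # A1)"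
      by (rule split_at_least_letter[of A \<mu>]) (use ge in auto)
    obtain B0 where B0: "\<forall>x\<in>set B0. \<mu> < x"
      "B = B0 \<and> \<mu> \<notin> set B \<or> (\<exists>B1. B = B0 @ \<mu> # B1)"
      by (rule split_at_least_letter[of B \<mu>]) (use ge in auto)
    \<comment> \<open>X derives \<langle>\<mu>\<rangle>X1, so if the induction hypothesis makes X1
      derive \<langle>\<mu>\<rangle>Y or equivalent to Y, then X derives
      \<langle>\<mu>\<rangle>Y.\<close>
    have tail: "worm X \<turnstile> Dia \<mu> (worm Y) \<or> worm Y \<turnstile> Dia \<mu> (worm X1)"
      if X: "X = X0 @ \<mu> # X1" "\<forall>x\<in>set X \<union> set Y. \<mu> \<le> x"
        "length X + length Y = length A + length B" for X X0 X1 Y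
    proof -
      have X1: "worm X \<turnstile> Dia \<mu> (worm X1)" using X by (auto intro: worm_suffix)
      have "worm X1 \<turnstile> Dia \<mu> (worm Y) \<or> worm Y \<turnstile> Dia \<mu> (worm X1) \<or> X1 \<approx> Y"
        using X by (intro less.hyps) auto
      then show ?thesis
        using rc_cut[OF rc_cut_dia[OF X1] rc_trans4] rc_cut_dia[OF X1]
        by (auto simp: equi_def)
    qed
    have join: "worm Y \<turnstile> worm X"
      if "worm Y \<turnstile> worm X0" "\<forall>x\<in>set X0. \<mu> < x" "X = X0 \<or> (\<exists>X1. X = X0 @ \<mu> # X1)"
        "\<forall>X1. X = X0 @ \<mu> # X1 \<longrightarrow> worm Y \<turnstile> Dia \<mu> (worm X1)" for X X0 Y
      using that by (auto intro: worm_joinI)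
    have dia: "worm Y \<turnstile> Dia \<mu> (worm X)"
      if Y: "worm Y \<turnstile> Dia (suc_o \<mu>) (worm X0)"
        and X: "\<forall>x\<in>set X0. \<mu> < x" "X = X0 \<or> (\<exists>X1. X = X0 @ \<mu> # X1)"
        "\<forall>X1. X = X0 @ \<mu> # X1 \<longrightarrow> worm Y \<turnstile> Dia \<mu> (worm X1)" for X X0 Y
    proof -
      have "worm Y \<turnstile> worm (suc_o \<mu> # X)"
        using X(2)
      proof
        assume "\<exists>X1. X = X0 @ \<mu> # X1"
        then obtain X1 where "X = X0 @ \<mu> # X1" ..
        then show ?thesis
          using worm_joinI[of "suc_o \<mu> # X0" \<mu> "worm Y" X1] X Y by (simp add: less_suc_o)
      qed (use Y in simp)
      then show ?thesis using rc_cut[OF _ rc_mono_le] less_suc_o less_imp_le by (metis worm_simps(2))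
    qed
    have res: "worm A \<turnstile> Dia \<mu> (worm B) \<or> worm B \<turnstile> Dia \<mu> (worm A) \<or> A \<approx> B"
    proof (rule ccontr)
      assume neg: "\<not> ?thesis"
      have tA: "\<forall>A1. A = A0 @ \<mu> # A1 \<longrightarrow> worm B \<turnstile> Dia \<mu> (worm A1)"
        using tail[of A A0 _ B] ge neg by blast
      have tB: "\<forall>B1. B = B0 @ \<mu> # B1 \<longrightarrow> worm A \<turnstile> Dia \<mu> (worm B1)"
        using tail[of B B0 _ A] ge neg by (metis Un_commute add.commute)
      have prefix: "worm A \<turnstile> worm A0" "worm B \<turnstile> worm B0"
        using A0(2) B0(2) worm_prefix rc_refl by blast+
      \<comment> \<open>The letter \<mu> occurs in A or B, so the heads are shorter in total, and
        their letters are at least \<open>suc_o \<mu>\<close>.\<close>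
      have "worm A0 \<turnstile> Dia (suc_o \<mu>) (worm B0) \<or> worm B0 \<turnstile> Dia (suc_o \<mu>) (worm A0) \<or> A0 \<approx> B0"
        using A0 B0 \<mu> by (intro less.hyps) (auto simp: suc_o_le)
      then consider "worm A \<turnstile> Dia (suc_o \<mu>) (worm B0)" | "worm B \<turnstile> Dia (suc_o \<mu>) (worm A0)"
        | "worm A \<turnstile> worm B0" "worm B \<turnstile> worm A0"
        using prefix by (auto simp: equi_def intro: rc_cut)
      then show False
      proof cases
        case 1
        then have "worm A \<turnstile> Dia \<mu> (worm B)" using B0 tB by (intro dia) auto
        then show False using neg by simp
      next
        case 2
        then have "worm B \<turnstile> Dia \<mu> (worm A)" using A0 tA by (intro dia) auto
        then show False using neg by simp
      next
        case 3
        have "worm A \<turnstile> worm B"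
          by (rule join[OF 3(1) B0(1) _ tB]) (use B0(2) in blast)
        moreover have "worm B \<turnstile> worm A"
          by (rule join[OF 3(2) A0(1) _ tA]) (use A0(2) in blast)
        ultimately show False using neg by (simp add: equi_def)
      qed
    qed
    then show ?thesis using rc_cut[OF _ rc_mono_le[OF \<open>\<alpha> \<le> \<mu>\<close>]] by blast
  qed simp
qed

lemma prec_linear: "A \<prec> B \<or> B \<prec> A \<or> A \<approx> B"
  using worm_trichotomy[of A B zero_o] by (auto simp: prec_def zero_o_le)

text \<open>The other two cases of the trichotomy at level \<alpha> contradict
  \<open>A \<prec> B\<close>. The stronger diamond is what allows smaller letters to be imported
  beneath it.\<close>

lemma derives_dia_if_prec:
  assumes "\<forall>x\<in>set A \<union> set B. \<alpha> \<le> x" and "A \<prec> B"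
  shows "worm B \<turnstile> Dia \<alpha> (worm A)"
  using worm_trichotomy[OF assms(1)] assms(2) derives_dia_prec prec_asym equi_not_prec by blast

lemma Nil_least: "\<not> A \<prec> []"
proof (cases A)
  case (Cons a A')
  have "worm A \<turnstile> Dia a (worm [])" using Cons by (simp add: rc_dia rc_top)
  then show ?thesis using derives_dia_prec prec_asym by blast
qed simp

lemma prec_Cons: "A \<prec> a # A"
  by (rule derives_dia_prec[of _ a]) (simp add: rc_refl)

lemma prec_append: "A \<prec> B \<Longrightarrow> A \<prec> S @ B"
  by (induction S) (auto intro: prec_trans[OF _ prec_Cons])

lemma prec_append_Cons: "T \<prec> S @ a # T"
  by (rule prec_append[OF prec_Cons])

subsection \<open>Raising the letters of a worm\<close>

definition shift :: "'o::ordinals \<Rightarrow> 'o list \<Rightarrow> 'o list" where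
  "shift \<alpha> A = map ((+\<^sub>o) \<alpha>) A"

lemma shift_simps [simp]:
  "shift \<alpha> [] = []" "shift \<alpha> (a # A) = (\<alpha> +\<^sub>o a) # shift \<alpha> A"
  "shift \<alpha> (A @ B) = shift \<alpha> A @ shift \<alpha> B" "length (shift \<alpha> A) = length A"
  by (simp_all add: shift_def)

lemma shift_shift: "shift \<alpha> (shift \<beta> A) = shift (\<alpha> +\<^sub>o \<beta>) A"
  by (simp add: shift_def plus_o_assoc)

lemma shift_zero [simp]: "shift zero_o A = A"
  by (simp add: shift_def map_idI)

lemma shift_ge: "x \<in> set (shift \<alpha> A) \<Longrightarrow> \<alpha> \<le> x"
  by (auto simp: shift_def le_plus_o)

lemma range_shift: "range (shift \<alpha>) = {A. \<forall>x\<in>set A. \<alpha> \<le> x}"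
proof
  show "{A. \<forall>x\<in>set A. \<alpha> \<le> x} \<subseteq> range (shift \<alpha>)"
  proof
    fix A assume "A \<in> {A. \<forall>x\<in>set A. \<alpha> \<le> x}"
    then have "\<forall>x\<in>set A. \<exists>y. x = \<alpha> +\<^sub>o y" by (metis mem_Collect_eq plus_o_difference)
    then show "A \<in> range (shift \<alpha>)" unfolding shift_def by (auto simp flip: ex_map_conv)
  qed
qed (auto dest: shift_ge)

lemma shift_cases:
  assumes "\<forall>x\<in>set A. \<alpha> \<le> x"
  obtains B where "A = shift \<alpha> B"
  using assms range_shift[of \<alpha>] by blast

lemma map_rc_form_derives:
  assumes "strict_mono f" and "\<phi> \<turnstile> \<psi>"
  shows "map_rc_form f \<phi> \<turnstile> map_rc_form f \<psi>"
  using assms(2)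
proof induction
  case (rc_cut \<phi> \<psi> \<chi>)
  from rc_cut.IH show ?case by (rule rc_derives.rc_cut)
qed (use strict_monoD[OF assms(1)] in \<open>auto intro: rc_derives.intros(1-7,9,10)\<close>)

lemma map_rc_form_worm: "map_rc_form f (worm A) = worm (map f A)"
  by (induction A) auto

lemma shift_derives: "worm A \<turnstile> worm B \<Longrightarrow> worm (shift \<alpha> A) \<turnstile> worm (shift \<alpha> B)"
  using map_rc_form_derives[OF strict_mono_plus_o[of \<alpha>], of "worm A" "worm B"]
  by (simp add: map_rc_form_worm shift_def)

text \<open>Shifting preserves both the order and equivalence, and linearity turns preservation into
  reflection. The image of \<langle>0\<rangle> is \<langle>\<alpha>\<rangle>, which weakens back to
  \<langle>0\<rangle>.\<close>

lemma shift_prec_iff [simp]: "shift \<alpha> A \<prec> shift \<alpha> B \<longleftrightarrow> A \<prec> B"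
proof -
  have *: "shift \<alpha> A \<prec> shift \<alpha> B" if "A \<prec> B" for A B
    using that shift_derives[of B "zero_o # A" \<alpha>]
    by (auto simp: prec_def plus_o_simps intro: derives_dia_prec[unfolded prec_def])
  moreover have "shift \<alpha> A \<approx> shift \<alpha> B" if "A \<approx> B"
    using that by (simp add: equi_def shift_derives)
  ultimately show ?thesis using prec_linear prec_asym equi_not_prec by blast
qed

subsection \<open>Appending a worm below the letter zero\<close>

text \<open>Extends appending from worms to all formulas, so that induction on derivations becomes
  possible: the final \<top> of a worm makes room for the appended worm.\<close>

fun subst_Top :: "'o rc_form \<Rightarrow> 'o rc_form \<Rightarrow> 'o rc_form" where
  "subst_Top \<chi> Top = \<chi>"
| "subst_Top \<chi> (Conj \<phi> \<psi>) = Conj (subst_Top \<chi> \<phi>) (subst_Top \<chi> \<psi>)"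
| "subst_Top \<chi> (Dia \<alpha> \<phi>) = Dia \<alpha> (subst_Top \<chi> \<phi>)"

lemma subst_Top_worm: "subst_Top (worm C) (worm A) = worm (A @ C)"
  by (induction A) auto

text \<open>Only the axiom for \<top> needs an argument: every substituted formula must derive
  \<langle>0\<rangle>\<chi>, which holds because any diamond in front of \<langle>0\<rangle>\<chi>
  is absorbed. Hence the zero in front of the appended worm.\<close>

lemma subst_Top_derives:
  assumes "\<phi> \<turnstile> \<psi>"
  shows "subst_Top (Dia zero_o \<chi>) \<phi> \<turnstile> subst_Top (Dia zero_o \<chi>) \<psi>"
  using assms
proof induction
  case (rc_top \<phi>)
  show ?case
  proof (induction \<phi>)
    case (Dia \<alpha> \<phi>)
    then show ?case using rc_cut[OF rc_dia rc_dia_dia[OF zero_o_le]] by simp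
  qed (auto intro: rc_refl rc_cut[OF rc_conj1])
next
  case (rc_cut \<phi> \<psi> \<chi>)
  from rc_cut.IH show ?case by (rule rc_derives.rc_cut)
qed (auto intro: rc_derives.intros(1,3-7,9,10))

lemma append_derives:
  "worm A \<turnstile> worm B \<Longrightarrow> worm (A @ zero_o # C) \<turnstile> worm (B @ zero_o # C)"
  using subst_Top_derives[of "worm A" "worm B" "worm C"] subst_Top_worm[of "zero_o # C"] by simp

lemma append_prec_iff [simp]: "A @ zero_o # C \<prec> B @ zero_o # C \<longleftrightarrow> A \<prec> B"
proof -
  have *: "A @ zero_o # C \<prec> B @ zero_o # C" if "A \<prec> B" for A B
    using that append_derives[of B "zero_o # A" C] by (simp add: prec_def)
  moreover have "A @ zero_o # C \<approx> B @ zero_o # C" if "A \<approx> B"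
    using that by (simp add: equi_def append_derives)
  ultimately show ?thesis using prec_linear prec_asym equi_not_prec by blast
qed

text \<open>Split D at its first zero as D0 0 D1. If D1 lies above C, recursion rewrites D1.
  Otherwise, or if D has no zero and D0 is D, the worm D is equivalent to D0 0 C.\<close>

lemma prec_equi_append:
  assumes "C \<prec> D"
  obtains B where "D \<approx> B @ zero_o # C"
proof -
  have "\<exists>B. D \<approx> B @ zero_o # C"
    using assms
  proof (induction "length D" arbitrary: D rule: less_induct)
    case less
    have C: "worm D \<turnstile> Dia zero_o (worm C)" using less.prems by (simp add: prec_def)
    show ?case
    proof (rule split_at_least_letter[of D zero_o])
      fix D0 assume D0: "\<forall>x\<in>set D0. zero_o < x" "D = D0"
      then have "D \<approx> D0 @ zero_o # C"
        unfolding equi_def using C by (auto intro: worm_joinI worm_prefix rc_refl)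
      then show ?thesis ..
    next
      fix D0 D1 assume D0: "\<forall>x\<in>set D0. zero_o < x" and D: "D = D0 @ zero_o # D1"
      consider "C \<prec> D1" | "C \<approx> D1" | "D1 \<prec> C" using prec_linear by blast
      then show ?thesis
      proof cases
        case 1
        then obtain B where "D1 \<approx> B @ zero_o # C" using less.hyps[of D1] D by auto
        then have "D \<approx> (D0 @ zero_o # B) @ zero_o # C"
          using worm_append_mono[of _ _ "D0 @ [zero_o]"] by (simp add: D equi_def)
        then show ?thesis ..
      next
        case 2
        then have "D \<approx> D0 @ zero_o # C"
          using worm_append_mono[of _ _ "D0 @ [zero_o]"] by (simp add: D equi_def)
        then show ?thesis ..
      next
        case 3
        have "worm D \<turnstile> worm D0" by (simp add: D worm_prefix)
        then have "worm D \<turnstile> worm (D0 @ zero_o # C)" using D0 C by (intro worm_joinI)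
        moreover have "worm (D0 @ zero_o # C) \<turnstile> Dia zero_o (worm D1)"
          using 3 unfolding prec_def
          by (intro rc_cut[OF rc_cut_dia[OF worm_suffix] rc_trans4]) (auto simp: zero_o_le)
        then have "worm (D0 @ zero_o # C) \<turnstile> worm D"
          unfolding D by (intro worm_joinI[OF D0] worm_prefix)
        ultimately show ?thesis by (auto simp: equi_def)
      qed
    qed (simp add: zero_o_le)
  qed
  with that show ?thesis by blast
qed

text \<open>A derives \<langle>1\<rangle> applied to the part of B before its first zero, and the
  rest, below A by induction, is imported beneath \<langle>1\<rangle>. In ordinals, 1 + o(A) is
  additively indecomposable.\<close>

lemma append_prec_closed:
  assumes A: "\<forall>x\<in>set A. one_o \<le> x" and "B \<prec> A" and "C \<prec> A"
  shows "B @ zero_o # C \<prec> A"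
  using assms(2)
proof (induction "length B" arbitrary: B rule: less_induct)
  case less
  show ?case
  proof (rule split_at_least_letter[of B zero_o])
    fix B0 assume B0: "\<forall>x\<in>set B0. zero_o < x" "B = B0"
    then have "worm A \<turnstile> Dia one_o (worm B)"
      using A less.prems by (intro derives_dia_if_prec) (auto simp: one_o_def suc_o_le)
    then have "worm A \<turnstile> worm ((one_o # B) @ zero_o # C)"
      using assms(3) B0 by (intro worm_joinI) (auto simp: prec_def one_o_def less_suc_o)
    then show ?thesis using derives_dia_prec by simp
  next
    fix B0 B1 assume B0: "\<forall>x\<in>set B0. zero_o < x" and B: "B = B0 @ zero_o # B1"
    have "B1 \<prec> A" using less.prems B prec_append_Cons prec_trans by blast
    then have B1: "B1 @ zero_o # C \<prec> A" using less.hyps B by simp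
    have "B0 \<prec> A" using less.prems B worm_prefix derives_prec by blast
    then have "worm A \<turnstile> Dia one_o (worm B0)"
      using A B0 by (intro derives_dia_if_prec) (auto simp: one_o_def suc_o_le)
    then have "worm A \<turnstile> worm ((one_o # B0) @ zero_o # B1 @ zero_o # C)"
      using B1 B0 by (intro worm_joinI) (auto simp: prec_def one_o_def less_suc_o)
    then show ?thesis using derives_dia_prec B by simp
  qed (simp add: zero_o_le)
qed

section \<open>Well-foundedness\<close>

lemma worm_least_letterE:
  assumes "A \<noteq> []"
  obtains B C where "A = shift (Min (set A)) (B @ zero_o # C)"
proof -
  let ?\<mu> = "Min (set A)"
  obtain A' where A': "A = shift ?\<mu> A'"
    by (rule shift_cases[of A ?\<mu>]) auto
  have "?\<mu> \<in> set A" using assms by (intro Min_in) auto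
  then obtain a where "a \<in> set A'" "?\<mu> +\<^sub>o a = ?\<mu>"
    using arg_cong[OF A', of set] by (metis (no_types, lifting) image_iff list.set_map shift_def)
  then have "zero_o \<in> set A'"
    using plus_o_eq_iff[of ?\<mu> a zero_o] by (simp add: plus_o_simps)
  then show ?thesis using that A' by (metis split_list)
qed

text \<open>Both uses are inside an induction on \<alpha>. In \<open>shorten\<close> that induction
  applies at \<gamma> and then at \<beta>; in \<open>append\<close> the remainder is \<alpha>
  itself, so the information on B and C comes from their being shorter.\<close>

lemma prec_shift_induct [consumes 1, case_names shift shorten append]:
  assumes "C \<prec> shift \<alpha> A"
    and shift: "\<And>B. B \<prec> A \<Longrightarrow> P (shift \<alpha> B)"
    and shorten: "\<And>\<beta> \<gamma> B. \<beta> < \<alpha> \<Longrightarrow> \<gamma> < \<alpha> \<Longrightarrow> \<beta> +\<^sub>o \<gamma> = \<alpha> \<Longrightarrow> B \<prec> shift \<gamma> A \<Longrightarrow> P (shift \<beta> B)"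
    and append: "\<And>\<beta> B C. \<beta> < \<alpha> \<Longrightarrow> \<beta> +\<^sub>o \<alpha> = \<alpha> \<Longrightarrow> B \<prec> shift \<alpha> A \<Longrightarrow> C \<prec> shift \<alpha> A \<Longrightarrow>
      P B \<Longrightarrow> P C \<Longrightarrow> P (shift \<beta> (B @ zero_o # C))"
  shows "P C"
  using assms(1)
proof (induction "length C" arbitrary: C rule: less_induct)
  case less
  show ?case
  proof (cases "\<forall>x\<in>set C. \<alpha> \<le> x")
    case True
    then obtain B where "C = shift \<alpha> B" by (rule shift_cases)
    then show ?thesis using less.prems by (simp add: shift)
  next
    case False
    then have "C \<noteq> []" by auto
    define \<beta> where "\<beta> = Min (set C)"
    from \<open>C \<noteq> []\<close> obtain B D where C: "C = shift \<beta> (B @ zero_o # D)"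
      unfolding \<beta>_def by (rule worm_least_letterE)
    have "\<beta> < \<alpha>" using False unfolding \<beta>_def by (auto simp: not_le intro: order_le_less_trans[OF Min_le])
    then obtain \<gamma> where \<gamma>: "\<beta> +\<^sub>o \<gamma> = \<alpha>" using plus_o_difference less_imp_le by metis
    then have BD: "B @ zero_o # D \<prec> shift \<gamma> A"
      using less.prems unfolding C by (metis shift_prec_iff shift_shift)
    show ?thesis
    proof (cases "\<gamma> = \<alpha>")
      case True
      have "B \<prec> shift \<alpha> A" "D \<prec> shift \<alpha> A"
        using BD True worm_prefix derives_prec prec_append_Cons prec_trans by metis+
      then show ?thesis
        using append[of \<beta> B D] less.hyps \<open>\<beta> < \<alpha>\<close> \<gamma> True unfolding C by simp
    next
      case False
      then have "\<gamma> < \<alpha>" using le_plus_o'[of \<gamma> \<beta>] \<gamma> by simp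
      then show ?thesis using shorten[OF \<open>\<beta> < \<alpha>\<close> _ \<gamma> BD] unfolding C by blast
    qed
  qed
qed

lemma accp_prec_derives:
  assumes "Wellfounded.accp (\<prec>) A" and "worm A \<turnstile> worm B"
  shows "Wellfounded.accp (\<prec>) B"
proof (rule accp.accI)
  fix C assume "C \<prec> B"
  then have "C \<prec> A" using assms(2) by (rule prec_derives)
  with assms(1) show "Wellfounded.accp (\<prec>) C" by (rule accp_downward)
qed

text \<open>A worm below A0C either lies at or below C, or is equivalent to some B0C, in which case
  B lies below A and induction applies.\<close>

lemma accp_prec_append:
  assumes "Wellfounded.accp (\<prec>) A" and "Wellfounded.accp (\<prec>) C"
  shows "Wellfounded.accp (\<prec>) (A @ zero_o # C)"
  using assms(1)
proof (induction A rule: accp_induct_rule)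
  case (1 A)
  show ?case
  proof (rule accp.accI)
    fix D assume D: "D \<prec> A @ zero_o # C"
    show "Wellfounded.accp (\<prec>) D"
    proof (rule disjE[OF prec_linear[of C D]])
      assume "C \<prec> D"
      then obtain B where B: "D \<approx> B @ zero_o # C" by (rule prec_equi_append)
      then have "B @ zero_o # C \<prec> A @ zero_o # C"
        using derives_prec[OF _ D] unfolding equi_def by blast
      then have "Wellfounded.accp (\<prec>) (B @ zero_o # C)" using 1(2) by simp
      then show ?thesis using B unfolding equi_def by (blast intro: accp_prec_derives)
    next
      assume "D \<prec> C \<or> C \<approx> D"
      then show ?thesis
        using accp_downward[OF assms(2)] accp_prec_derives[OF assms(2)] unfolding equi_def by blast
    qed
  qed
qed

lemma accp_prec_shift: "Wellfounded.accp (\<prec>) A \<Longrightarrow> Wellfounded.accp (\<prec>) (shift \<alpha> A)"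
proof (induction \<alpha> arbitrary: A rule: less_induct)
  case (less \<alpha>)
  show ?case
    using less.prems
  proof (induction A rule: accp_induct_rule)
    case (1 A)
    show ?case
    proof (rule accp.accI)
      fix C assume "C \<prec> shift \<alpha> A"
      then show "Wellfounded.accp (\<prec>) C"
      proof (induction rule: prec_shift_induct)
        case (shift B)
        then show ?case by (rule 1(2))
      next
        case (shorten \<beta> \<gamma> B)
        have "Wellfounded.accp (\<prec>) (shift \<gamma> A)" by (rule less.IH[OF shorten(2) 1(1)])
        then have "Wellfounded.accp (\<prec>) B" using shorten(4) by (rule accp_downward)
        then show ?case by (rule less.IH[OF shorten(1)])
      next
        case (append \<beta> B D)
        then show ?case by (intro less.IH[OF append(1)] accp_prec_append)
      qed
    qed
  qed
qed

text \<open>Subtracting the least letter exposes a zero, so a nonempty worm arises from two shorter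
  worms by B0C and a shift, both of which preserve accessibility.\<close>

lemma accp_prec: "Wellfounded.accp (\<prec>) (A :: 'o::ordinals list)"
proof (induction "length A" arbitrary: A rule: less_induct)
  case less
  show ?case
  proof (cases "A = []")
    case True
    then show ?thesis using Nil_least accp.accI by metis
  next
    case False
    then obtain B C where A: "A = shift (Min (set A)) (B @ zero_o # C)" by (rule worm_least_letterE)
    have "length A = length (shift (Min (set A)) (B @ zero_o # C))" using A by (rule arg_cong)
    then have "length B < length A" "length C < length A" by simp_all
    then have "Wellfounded.accp (\<prec>) (shift (Min (set A)) (B @ zero_o # C))"
      using less by (intro accp_prec_shift accp_prec_append)
    then show ?thesis using A by simp
  qed
qed

lemma wf_prec: "wf {(B, A). B \<prec> A}"
  using accp_wfpI[of "(\<prec>)"] accp_prec by (auto simp: wfp_def)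

section \<open>The order types of worms\<close>

definition rank :: "'o::ordinals list \<Rightarrow> 'o" where
  "rank A = worm_order (worm A)"

lemma wf_less_worm: "wf {(B, A). B \<in> worms \<and> A \<in> worms \<and> B <\<^sub>0 A}"
  by (rule wf_subset[OF wf_inv_image[OF wf_prec, of "inv worm"]])
    (auto simp: prec_def less_worm_def f_inv_into_f simp flip: range_worm)

lemma rank_unfold: "rank A = sup_o {suc_o (rank B) | B. B \<prec> A}"
proof -
  let ?F = "\<lambda>r A. sup_o {suc_o (r B) | B. B \<in> worms \<and> B <\<^sub>0 A}"
  let ?R = "{(B, A). B \<in> worms \<and> A \<in> worms \<and> B <\<^sub>0 (A :: 'a rc_form)}"
  have "rank A = sup_o {suc_o (cut worm_order ?R (worm A) B) | B. B \<in> worms \<and> B <\<^sub>0 worm A}"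
    unfolding rank_def worm_order_def by (subst wfrec[OF wf_less_worm]) (rule refl)
  also have "{suc_o (cut worm_order ?R (worm A) B) | B. B \<in> worms \<and> B <\<^sub>0 worm A}
      = {suc_o (rank B) | B. B \<prec> A}"
    by (force simp: cut_def rank_def prec_def less_worm_def simp flip: range_worm)
  finally show ?thesis .
qed

text \<open>A single letter x \<ge> m already derives \<langle>0\<rangle>A, importing A letter by
  letter, so a worm containing x lies above A. This confines the supremum in \<open>rank A\<close>
  to lists over an initial segment.\<close>

lemma prec_letters_less:
  assumes "\<forall>x\<in>set A. x < m" and "zero_o < m" and "B \<prec> A"
  shows "\<forall>x\<in>set B. x < m"
proof (rule ccontr)
  assume "\<not> ?thesis"
  then obtain S x T where B: "B = S @ x # T" and "m \<le> x" by (auto simp: not_less dest: split_list)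
  have "worm [x] \<turnstile> Dia a (worm A')" if "\<forall>b\<in>set (a # A'). b < m" for a A'
    using that
  proof (induction A' arbitrary: a)
    case Nil
    then show ?case using \<open>m \<le> x\<close> by (auto intro: rc_mono_le)
  next
    case (Cons b A')
    then have "worm [x] \<turnstile> worm ([x] @ b # A')"
      using \<open>m \<le> x\<close> by (intro worm_joinI) (auto intro: rc_refl)
    moreover have "worm ([x] @ b # A') \<turnstile> Dia a (worm (b # A'))"
      using Cons.prems \<open>m \<le> x\<close> by (auto intro: rc_mono_le)
    ultimately show ?case by (rule rc_cut)
  qed
  then have "A \<prec> [x]" using assms(1,2) by (auto simp: prec_def)
  then have "A \<prec> x # T" by (rule prec_derives) (simp add: rc_dia rc_top)
  then have "A \<prec> B" unfolding B by (rule prec_append)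
  then show False using assms(3) prec_asym by blast
qed

lemma rank_less: "B \<prec> A \<Longrightarrow> rank B < rank A"
proof -
  assume "B \<prec> A"
  \<comment> \<open>Inserting zero makes the maximum defined even when A is empty and keeps m
    positive.\<close>
  define m where "m = suc_o (Max (insert zero_o (set A)))"
  have m: "x < m" if "x = zero_o \<or> x \<in> set A" for x
    using that unfolding m_def less_suc_o_iff by (intro Max_ge) auto
  obtain b where b: "\<And>xs. \<forall>x\<in>set xs. x < m \<Longrightarrow> suc_o (rank xs) \<le> b"
    using bounded_on_lists[of m "\<lambda>xs. suc_o (rank xs)"] by blast
  have "suc_o (rank B) \<le> b" if "B \<prec> A" for B
    by (rule b[OF prec_letters_less[OF _ _ that]]) (simp_all add: m)
  then have "\<forall>y\<in>{suc_o (rank B) | B. B \<prec> A}. y \<le> b"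
    by blast
  then have "suc_o (rank B) \<le> rank A"
    unfolding rank_unfold[of A] by (rule sup_o_upper) (use \<open>B \<prec> A\<close> in blast)
  then show ?thesis by (simp add: suc_o_le_iff)
qed

lemma rank_equi: "A \<approx> B \<Longrightarrow> rank A = rank B"
  unfolding rank_unfold[of A] rank_unfold[of B] equi_def by (metis prec_derives)

lemma rank_less_iff [simp]: "rank A < rank B \<longleftrightarrow> A \<prec> B"
  using rank_less prec_linear rank_equi by (metis less_irrefl less_asym)

lemma rank_eq_iff: "rank A = rank B \<longleftrightarrow> A \<approx> B"
  using rank_equi prec_linear rank_less by (metis less_irrefl)

lemma rank_le_iff: "rank A \<le> rank B \<longleftrightarrow> \<not> B \<prec> A"
  by (simp flip: not_less)

text \<open>Unless some predecessor of A had rank at least x, the supremum defining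
  \<open>rank A\<close> would be at most x; descending along the order then hits x exactly.\<close>

lemma less_rankE:
  fixes A :: "'o::ordinals list"
  assumes "x < rank A"
  obtains B where "B \<prec> A" and "rank B = x"
proof -
  have "\<exists>B. B \<prec> A \<and> rank B = x"
    using accp_prec[of A] assms
  proof (induction A rule: accp_induct_rule)
    case (1 A)
    have "\<exists>B. B \<prec> A \<and> x \<le> rank B"
    proof (rule ccontr)
      assume "\<not> ?thesis"
      then have "rank A \<le> x"
        by (subst rank_unfold) (auto intro!: sup_o_least simp: suc_o_le_iff not_le)
      then show False using 1(3) by simp
    qed
    then show ?case using 1(2) prec_trans by (metis le_less)
  qed
  with that show ?thesis by blast
qed

text \<open>One-letter worms have strictly increasing ranks, so \<open>rank [x]\<close> is at least
  x, and ranks form an initial segment.\<close>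

lemma surj_rank: "surj rank"
proof (rule surjI)
  fix x :: 'a
  have mono: "strict_mono (\<lambda>x :: 'a. rank [x])"
  proof (rule strict_monoI)
    fix x y :: 'a assume "x < y"
    then have "worm [y] \<turnstile> worm ([y] @ [x])"
      by (intro worm_joinI) (auto intro: rc_refl rc_mono)
    moreover have "[x] \<prec> [y] @ [x]" by (simp add: prec_Cons)
    ultimately show "rank [x] < rank [y]" unfolding rank_less_iff by (metis prec_derives)
  qed
  have "\<exists>A. rank A = x"
    using less_rankE[of x "[x]"] strict_mono_ge_self[OF mono, of x] by (metis le_less)
  then show "rank (SOME A. rank A = x) = x" by (rule someI_ex)
qed

lemma rank_Nil: "rank [] = zero_o"
  using surj_rank by (metis Nil_least less_rankE not_less zero_o_le le_less)

text \<open>Up to equivalence, appending is an order isomorphism onto the worms above C, so both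
  sides enumerate the ordinals from \<open>suc_o (rank C)\<close> on. Representatives are chosen by
  \<open>inv rank\<close>.\<close>

lemma rank_append: "rank (A @ zero_o # C) = suc_o (rank C) +\<^sub>o rank A"
proof -
  have inv: "rank (inv rank x) = x" for x :: 'a using surj_rank by (rule surj_f_inv_f)
  have eq: "rank (inv rank (rank A) @ zero_o # C) = rank (A @ zero_o # C)" for A
    using inv[of "rank A"] unfolding rank_eq_iff by (auto simp: equi_def append_derives)
  have "(\<lambda>x. rank (inv rank x @ zero_o # C)) = (+\<^sub>o) (suc_o (rank C))"
  proof (rule strict_mono_range_unique)
    show "strict_mono (\<lambda>x. rank (inv rank x @ zero_o # C))"
      by (rule strict_monoI) (simp add: inv flip: rank_less_iff[of "inv rank _" "inv rank _"])
    show "strict_mono ((+\<^sub>o) (suc_o (rank C)))" by (rule strict_mono_plus_o)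
    have "rank D \<in> range (\<lambda>x. rank (inv rank x @ zero_o # C))" if CD: "C \<prec> D" for D
    proof -
      obtain B where "D \<approx> B @ zero_o # C" using CD by (rule prec_equi_append)
      then have "rank D = rank (inv rank (rank B) @ zero_o # C)"
        unfolding eq by (simp add: rank_eq_iff)
      then show ?thesis by blast
    qed
    then have "suc_o (rank C) \<le> x \<Longrightarrow> x \<in> range (\<lambda>x. rank (inv rank x @ zero_o # C))" for x
      using inv[of x] by (metis rank_less_iff suc_o_le_iff)
    then show "range (\<lambda>x. rank (inv rank x @ zero_o # C)) = range ((+\<^sub>o) (suc_o (rank C)))"
      by (auto simp: range_plus_o suc_o_le_iff prec_append_Cons)
  qed
  from fun_cong[OF this, of "rank A"] show ?thesis by (simp add: eq)
qed

lemma rank_Cons_zero: "rank (zero_o # A) = suc_o (rank A)"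
  using rank_append[of "[]" A] by (simp add: rank_Nil plus_o_simps)

section \<open>The worm enumerators\<close>

text \<open>Shifting preserves the order and its range consists of the worms with letters at least
  \<alpha>, so the induced map on ranks is the enumeration.\<close>

lemma worm_enumerator_rank: "worm_enumerator \<alpha> (rank A) = rank (shift \<alpha> A)"
proof -
  have inv: "rank (inv rank x) = x" for x :: 'a using surj_rank by (rule surj_f_inv_f)
  have eq: "rank (shift \<alpha> (inv rank (rank A))) = rank (shift \<alpha> A)" for A
    using inv[of "rank A"] unfolding rank_eq_iff by (auto simp: equi_def shift_derives)
  have "worm_enumerator \<alpha> = (\<lambda>x. rank (shift \<alpha> (inv rank x)))"
    unfolding worm_enumerator_def
  proof (rule enumerator_eq)
    show "strict_mono (\<lambda>x. rank (shift \<alpha> (inv rank x)))"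
      by (rule strict_monoI) (simp add: inv flip: rank_less_iff[of "inv rank _" "inv rank _"])
    have "worms_ge \<alpha> = worm ` range (shift \<alpha>)"
      by (auto simp: worms_ge_def range_shift modalities_worm simp flip: range_worm)
    then have "worm_order ` worms_ge \<alpha> = range (\<lambda>A. rank (shift \<alpha> A))"
      by (auto simp: rank_def)
    moreover have "rank (shift \<alpha> A) \<in> range (\<lambda>x. rank (shift \<alpha> (inv rank x)))" for A
      by (metis eq rangeI)
    ultimately show "range (\<lambda>x. rank (shift \<alpha> (inv rank x))) = worm_order ` worms_ge \<alpha>"
      by auto
  qed
  then show ?thesis by (simp add: eq)
qed

text \<open>
  This gives continuity of \<open>\<sigma>\<^sup>\<alpha>\<close>: if \<open>D\<close> is \<open>\<alpha>\<up>B\<close>, then \<open>\<langle>\<alpha>\<rangle>D\<close> is the image of the successor of \<open>B\<close>.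
\<close>

lemma prec_bounded_by_dia:
  assumes A: "\<forall>x\<in>set A. \<alpha> \<le> x" and "C \<prec> A"
  shows "\<exists>D. (\<forall>x\<in>set D. \<alpha> \<le> x) \<and> D \<prec> A \<and> worm (\<alpha> # D) \<turnstile> Dia \<alpha> (worm C)"
  using assms(2)
proof (induction "length C" arbitrary: C rule: less_induct)
  case less
  show ?case
  proof (cases "\<forall>x\<in>set C. \<alpha> \<le> x")
    case True
    then show ?thesis using less.prems by (intro exI[of _ C]) (auto intro: rc_refl)
  next
    case False
    then have "\<exists>x\<in>set C. x < \<alpha>" by (auto simp: not_le)
    then obtain B \<beta> C' where C: "C = B @ \<beta> # C'" and "\<beta> < \<alpha>" and "\<forall>x\<in>set B. \<not> x < \<alpha>"
      using split_list_first_prop[of C "\<lambda>x. x < \<alpha>"] by blast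
    then have B: "\<forall>x\<in>set B. \<alpha> \<le> x" by (simp add: not_less)
    have "C' \<prec> A" using less.prems prec_append_Cons prec_trans unfolding C by blast
    then obtain D' where D': "\<forall>x\<in>set D'. \<alpha> \<le> x" "D' \<prec> A" "worm (\<alpha> # D') \<turnstile> Dia \<alpha> (worm C')"
      using less.hyps[of C'] C by auto
    have "B \<prec> A" using less.prems worm_prefix derives_prec unfolding C by blast
    have dia: "Dia \<alpha> (worm Y) \<turnstile> Dia \<alpha> (worm X)"
      if "X \<prec> Y \<or> X \<approx> Y" "\<forall>x\<in>set X \<union> set Y. \<alpha> \<le> x" for X Y
      using that(1)
    proof
      assume "X \<prec> Y"
      with that(2) have "worm Y \<turnstile> Dia \<alpha> (worm X)" by (rule derives_dia_if_prec)
      then show ?thesis by (rule rc_cut[OF rc_dia rc_trans4])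
    qed (auto simp: equi_def intro: rc_dia)
    \<comment> \<open>D is the larger of the head B and the bound D' for the tail, so
      \<langle>\<alpha>\<rangle>D derives what both of them provide.\<close>
    have "B \<prec> D' \<or> B \<approx> D' \<or> D' \<prec> B" using prec_linear by blast
    then obtain D where D: "D \<in> {B, D'}" "B \<prec> D \<or> B \<approx> D" "D' \<prec> D \<or> D' \<approx> D"
      using equi_refl by blast
    have "worm (\<alpha> # D) \<turnstile> Dia \<alpha> (worm D')" "worm (\<alpha> # D) \<turnstile> worm (\<alpha> # B)"
      using D B D'(1) by (auto intro!: dia)
    moreover from this(1) have "worm (\<alpha> # D) \<turnstile> Dia \<beta> (worm C')"
      using D'(3) \<open>\<beta> < \<alpha>\<close> by (auto intro: rc_cut[OF rc_cut rc_mono])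
    ultimately have "worm (\<alpha> # D) \<turnstile> worm ((\<alpha> # B) @ \<beta> # C')"
      using B \<open>\<beta> < \<alpha>\<close> by (intro worm_joinI) auto
    then have "worm (\<alpha> # D) \<turnstile> Dia \<alpha> (worm C)" by (simp add: C)
    then show ?thesis using D(1) B D'(1,2) \<open>B \<prec> A\<close> by blast
  qed
qed

lemma normal_worm_enumerator: "normal (worm_enumerator \<alpha>)"
proof (rule normalI_limit_le)
  show "strict_mono (worm_enumerator \<alpha>)"
  proof (rule strict_monoI)
    fix x y :: 'a assume "x < y"
    moreover obtain A B where "x = rank A" "y = rank B" using surj_rank by (metis surjD)
    ultimately show "worm_enumerator \<alpha> x < worm_enumerator \<alpha> y"
      by (simp add: worm_enumerator_rank)
  qed
  fix l b :: 'a
  assume l: "is_limit l" and b: "\<And>x. x < l \<Longrightarrow> worm_enumerator \<alpha> x \<le> b"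
  obtain A where A: "l = rank A" using surj_rank by (metis surjD)
  show "worm_enumerator \<alpha> l \<le> b"
  proof (rule ccontr)
    assume "\<not> ?thesis"
    then obtain C where C: "C \<prec> shift \<alpha> A" "rank C = b"
      by (auto simp: A worm_enumerator_rank not_le elim: less_rankE)
    then obtain D where D: "\<forall>x\<in>set D. \<alpha> \<le> x" "D \<prec> shift \<alpha> A" "worm (\<alpha> # D) \<turnstile> Dia \<alpha> (worm C)"
      using prec_bounded_by_dia[of "shift \<alpha> A" \<alpha> C] shift_ge by blast
    from D(1) obtain B where B: "D = shift \<alpha> B" by (rule shift_cases)
    have "rank B < l" using D(2) by (simp add: B A)
    \<comment> \<open>As l is a limit, the successor \<langle>0\<rangle>B still ranks below l,
      although its image lies above C.\<close>
    then have "rank (zero_o # B) < l" using is_limit_suc_less[OF l] by (simp add: rank_Cons_zero)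
    then have "rank (shift \<alpha> (zero_o # B)) \<le> b" by (metis b worm_enumerator_rank)
    moreover have "C \<prec> shift \<alpha> (zero_o # B)"
      using derives_dia_prec[OF D(3)] by (simp add: B plus_o_simps)
    ultimately show False by (metis C(2) rank_less not_le)
  qed
qed

lemma worm_enumerator_zero: "worm_enumerator zero_o = id"
proof
  fix x :: 'a
  obtain A where "x = rank A" using surj_rank by (metis surjD)
  then show "worm_enumerator zero_o x = id x" by (simp add: worm_enumerator_rank)
qed

lemma worm_enumerator_plus:
  "worm_enumerator (\<alpha> +\<^sub>o \<beta>) = worm_enumerator \<alpha> \<circ> worm_enumerator \<beta>"
proof
  fix x :: 'a
  obtain A where "x = rank A" using surj_rank by (metis surjD)
  then show "worm_enumerator (\<alpha> +\<^sub>o \<beta>) x = (worm_enumerator \<alpha> \<circ> worm_enumerator \<beta>) x"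
    by (simp add: worm_enumerator_rank shift_shift)
qed

section \<open>The enumerator at one is e\<close>

lemma one_plus_rank_append:
  "one_o +\<^sub>o rank (A @ zero_o # C) = (one_o +\<^sub>o rank C) +\<^sub>o (one_o +\<^sub>o rank A)"
  by (simp add: rank_append plus_o_assoc flip: plus_o_one)

text \<open>Let u be 1 + o(D). Prepending D0 repeatedly stays below \<langle>1\<rangle>D and reaches
  each multiple u n. Conversely, the blocks between zeros of a worm below \<langle>1\<rangle>D rank
  at most D, so n blocks give at most u n.\<close>

lemma one_plus_rank_dia_one:
  assumes "\<forall>x\<in>set D. one_o \<le> x"
  shows "one_o +\<^sub>o rank (one_o # D) = (one_o +\<^sub>o rank D) *\<^sub>o omega_o"
proof (rule antisym)
  let ?u = "one_o +\<^sub>o rank D"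
  have D: "D \<prec> one_o # D" by (rule prec_Cons)
  have "\<exists>C. C \<prec> one_o # D \<and> ?u *\<^sub>o n \<le> one_o +\<^sub>o rank C" if "n < omega_o" for n
    using that
  proof (induction n rule: less_omega_o_induct)
    case zero
    have "[] \<prec> one_o # D" using derives_prec[OF _ D, of "[]"] by (simp add: rc_top)
    then show ?case by (auto simp: times_o_simps zero_o_le)
  next
    case (suc n)
    then obtain C where C: "C \<prec> one_o # D" "?u *\<^sub>o n \<le> one_o +\<^sub>o rank C" by blast
    have "D @ zero_o # C \<prec> one_o # D"
      using assms D C(1) by (intro append_prec_closed) auto
    moreover have "?u *\<^sub>o suc_o n \<le> one_o +\<^sub>o rank (D @ zero_o # C)"
      unfolding one_plus_rank_append times_o_simps using C(2) by (rule plus_o_mono_left)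
    ultimately show ?case by blast
  qed
  then show "?u *\<^sub>o omega_o \<le> one_o +\<^sub>o rank (one_o # D)"
    unfolding times_omega_o_le_iff by (meson less_imp_le order_trans plus_o_le_iff rank_less)
  have pos: "zero_o < ?u"
    using le_plus_o[of one_o "rank D"] by (simp add: one_o_def suc_o_le_iff)
  have times_less: "?u *\<^sub>o n < ?u *\<^sub>o omega_o" if "n < omega_o" for n
  proof -
    have "?u *\<^sub>o n < ?u *\<^sub>o suc_o n"
      using pos plus_o_less_iff[of "?u *\<^sub>o n" zero_o ?u] by (simp add: times_o_simps plus_o_simps)
    also have "\<dots> \<le> ?u *\<^sub>o omega_o"
      using is_limit_suc_less[OF is_limit_omega_o that] times_omega_o_le_iff by blast
    finally show ?thesis .
  qed
  \<comment> \<open>After a shift by one is removed, \<langle>1\<rangle>D becomes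
    \<langle>0\<rangle>A, whose rank is the successor of that of A.\<close>
  have le: "rank C \<le> rank D" if C: "C \<prec> one_o # D" "\<forall>x\<in>set C. one_o \<le> x" for C
  proof -
    obtain A B where "C = shift one_o B" "D = shift one_o A" using assms C(2) shift_cases by metis
    moreover from this have "B \<prec> zero_o # A"
      using C(1) shift_prec_iff[of one_o B "zero_o # A"] by (simp add: plus_o_simps)
    then have "rank B \<le> rank A" using rank_less[of B "zero_o # A"] by (simp add: rank_Cons_zero less_suc_o_iff)
    ultimately show ?thesis by (simp add: rank_le_iff)
  qed
  have bound: "\<exists>n < omega_o. one_o +\<^sub>o rank C \<le> ?u *\<^sub>o n" if "C \<prec> one_o # D" for C
    using that
  proof (induction "length C" arbitrary: C rule: less_induct)
    case less
    show ?case
    proof (rule split_at_least_letter[of C zero_o])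
      fix C0 assume "\<forall>x\<in>set C0. zero_o < x" "C = C0"
      then have "rank C \<le> rank D" using less.prems by (intro le) (auto simp: one_o_def suc_o_le)
      then have "one_o +\<^sub>o rank C \<le> ?u *\<^sub>o suc_o zero_o" by (simp add: times_o_simps)
      then show ?thesis
        using is_limit_suc_less is_limit_zero_less is_limit_omega_o by metis
    next
      fix C0 C1 assume C0: "\<forall>x\<in>set C0. zero_o < x" and C: "C = C0 @ zero_o # C1"
      have "C0 \<prec> one_o # D" using less.prems worm_prefix derives_prec unfolding C by blast
      then have "rank C0 \<le> rank D" using C0 by (intro le) (auto simp: one_o_def suc_o_le)
      moreover have "C1 \<prec> one_o # D" using less.prems prec_append_Cons prec_trans unfolding C by blast
      then obtain n where n: "n < omega_o" "one_o +\<^sub>o rank C1 \<le> ?u *\<^sub>o n"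
        using less.hyps[of C1] C by auto
      ultimately have "one_o +\<^sub>o rank C \<le> ?u *\<^sub>o n +\<^sub>o ?u"
        unfolding C one_plus_rank_append by (meson order_trans plus_o_le_iff plus_o_mono_left)
      then show ?thesis
        using is_limit_suc_less[OF is_limit_omega_o n(1)] by (metis times_o_simps(2))
    qed (simp add: zero_o_le)
  qed
  show "one_o +\<^sub>o rank (one_o # D) \<le> ?u *\<^sub>o omega_o"
  proof (rule ccontr)
    assume neg: "\<not> ?thesis"
    \<comment> \<open>The bound must be at least 1 to be written as 1 + x, with x then the rank of a
      worm.\<close>
    obtain n where "n < omega_o" "?u \<le> ?u *\<^sub>o n" using bound[OF D] by blast
    then have "one_o \<le> ?u *\<^sub>o omega_o"
      using times_less le_plus_o[of one_o "rank D"] by (meson less_imp_le order_trans)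
    then obtain x where x: "one_o +\<^sub>o x = ?u *\<^sub>o omega_o" by (rule plus_o_difference)
    then have "x < rank (one_o # D)" using neg by (simp flip: x add: not_le)
    then obtain C where "C \<prec> one_o # D" "rank C = x" by (rule less_rankE)
    then show False using bound[of C] times_less x by (metis not_le)
  qed
qed

text \<open>Both sides are continuous and agree at zero. At a successor, raising 0A by one puts
  \<langle>1\<rangle> in front of the raised A, which multiplies by omega.\<close>

lemma one_plus_worm_enumerator_one: "one_o +\<^sub>o worm_enumerator one_o x = omega_power x"
proof (rule continuous_eqI[of "\<lambda>x. one_o +\<^sub>o worm_enumerator one_o x"])
  show "one_o +\<^sub>o worm_enumerator one_o l
      = sup_o ((\<lambda>x. one_o +\<^sub>o worm_enumerator one_o x) ` {x. x < l})" if "is_limit l" for l :: 'a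
    using normal_comp[OF normal_plus_o normal_worm_enumerator] that unfolding normal_def by blast
  show "omega_power l = sup_o (omega_power ` {x. x < l})" if "is_limit l" for l :: 'a
    using omega_power_simps(3)[OF that] by (simp add: image_Collect)
  show "one_o +\<^sub>o worm_enumerator one_o zero_o = (omega_power zero_o :: 'a)"
    using worm_enumerator_rank[of one_o "[] :: 'a list"] by (simp add: rank_Nil omega_power_simps plus_o_simps)
  fix x :: 'a
  assume IH: "one_o +\<^sub>o worm_enumerator one_o x = omega_power x"
  obtain A where A: "x = rank A" using surj_rank by (metis surjD)
  have "one_o +\<^sub>o worm_enumerator one_o (suc_o x) = one_o +\<^sub>o rank (one_o # shift one_o A)"
    using worm_enumerator_rank[of one_o "zero_o # A"] by (simp add: A rank_Cons_zero plus_o_simps)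
  also have "\<dots> = (one_o +\<^sub>o rank (shift one_o A)) *\<^sub>o omega_o"
    using shift_ge by (intro one_plus_rank_dia_one) blast
  also have "\<dots> = omega_power (suc_o x)"
    using IH by (simp add: A worm_enumerator_rank omega_power_simps)
  finally show "one_o +\<^sub>o worm_enumerator one_o (suc_o x) = omega_power (suc_o x)" .
qed

lemma worm_enumerator_one: "worm_enumerator one_o = e_fun"
  by (rule ext) (simp add: e_fun_def left_minus_eq flip: one_plus_worm_enumerator_one)

lemma weak_hyperation_worm_enumerator: "weak_hyperation e_fun worm_enumerator"
  unfolding weak_hyperation_def
  by (metis normal_worm_enumerator worm_enumerator_zero worm_enumerator_one worm_enumerator_plus)

section \<open>Minimality\<close>

lemma worm_enumerator_le:
  assumes "weak_hyperation e_fun h"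
  shows "worm_enumerator \<alpha> x \<le> h \<alpha> x"
proof (induction \<alpha> arbitrary: x rule: less_induct)
  case (less \<alpha>)
  have mono: "strict_mono (h \<gamma>)" for \<gamma>
    using assms by (simp add: weak_hyperation_def normal_def)
  have plus: "h (\<beta> +\<^sub>o \<gamma>) y = h \<beta> (h \<gamma> y)" for \<beta> \<gamma> y
    using assms by (simp add: weak_hyperation_def)
  have raise: "rank (shift \<beta> B) < h (\<beta> +\<^sub>o \<gamma>) x" if "\<beta> < \<alpha>" "rank B < h \<gamma> x" for \<beta> \<gamma> B x
    using less.IH[OF that(1), of "rank B"] strict_monoD[OF mono that(2), of \<beta>]
    by (simp add: worm_enumerator_rank plus)
  show ?case
  proof (induction x rule: less_induct)
    fix x assume IH: "\<And>y. y < x \<Longrightarrow> worm_enumerator \<alpha> y \<le> h \<alpha> y"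
    obtain A where A: "x = rank A" using surj_rank by (metis surjD)
    have "rank C < h \<alpha> x" if "C \<prec> shift \<alpha> A" for C
      using that
    proof (induction rule: prec_shift_induct)
      case (shift B)
      then have "rank (shift \<alpha> B) \<le> h \<alpha> (rank B)"
        using IH[of "rank B"] by (simp add: A worm_enumerator_rank)
      also have "\<dots> < h \<alpha> x" using shift strict_monoD[OF mono] by (simp add: A)
      finally show ?case .
    next
      case (shorten \<beta> \<gamma> B)
      then have "rank B < rank (shift \<gamma> A)" by simp
      also have "\<dots> \<le> h \<gamma> x" using less.IH[OF shorten(2), of x] by (simp add: A worm_enumerator_rank)
      finally show ?case using raise[OF shorten(1)] shorten(3) by metis
    next
      case (append \<beta> B C)
      \<comment> \<open>As \<alpha> is positive, h at \<alpha> factors through h at one, which is e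
        and so the enumerator at one. Its values are ranks of worms with letters at least one, below
        which appending is closed.\<close>
      have "one_o \<le> \<alpha>" using append(1) zero_o_le[of \<beta>] by (simp add: one_o_def suc_o_le_iff)
      then obtain \<gamma> where \<gamma>: "one_o +\<^sub>o \<gamma> = \<alpha>" by (rule plus_o_difference)
      obtain Z where "h \<gamma> x = rank Z" using surj_rank by (metis surjD)
      then have Z: "h \<alpha> x = rank (shift one_o Z)"
        using assms by (simp add: plus weak_hyperation_def worm_enumerator_rank
            flip: \<gamma> worm_enumerator_one)
      have "B @ zero_o # C \<prec> shift one_o Z"
        using append(5,6) shift_ge unfolding Z by (intro append_prec_closed) auto
      then have "rank (B @ zero_o # C) < h \<alpha> x" by (simp add: Z)
      then show ?case using raise[OF append(1)] append(2) by metis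
    qed
    then show "worm_enumerator \<alpha> x \<le> h \<alpha> x"
      by (metis A less_rankE not_le less_irrefl worm_enumerator_rank)
  qed
qed

theorem theorem7p3:
  shows "is_hyperation (e_fun :: 'o::ordinals \<Rightarrow> 'o) (worm_enumerator :: 'o \<Rightarrow> 'o \<Rightarrow> 'o)"
  using weak_hyperation_worm_enumerator worm_enumerator_le
  by (auto simp: is_hyperation_def)

end
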